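(* Let $X$ be a real Banach space, let $G\subset\mathbb{R}^m$ be a bounded set with $G^{o}\neq\emptyset$ and $|G\setminus G^{o}|=0$, and let $I_0\in\mathcal{I}$ be a closed non-degenerate interval with $G\subset I_0$. Let $f:G\to X$ be a function, let $F:\mathcal{I}_G\to X$ be an additive interval function, and let $f_0:I_0\to X$ be defined by $f_0(t)=f(t)$ if $t\in G$ and $f_0(t)=0$ if $t\in I_0\setminus G$. Then the following statements are equivalent: (i) $f$ is Dunford-McShane integrable on $G$ with the primitive $F$; (ii) $f_0$ is McShane integrable on $I_0$ with a primitive $F_0:\mathcal{I}_{I_0}\to X$ such that $F_0(I)=F(I)$ for all $I\in\mathcal{I}_G$; (iii) $F$ is a Dunford-function and has $\mathcal{M}$-negligible variation outside of $G^{o}$, and given any division $(C_k)\in\mathscr{D}_{G^{o}}$, for each $k$ the restriction $f|_{C_k}$ is McShane integrable on $C_k$ with the primitive $F|_{\mathcal{I}_{C_k}}$.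
   Context: $\mathbb{R}^m$ carries the maximum norm; $B_m(t,r)$ is the open ball with center $t$ and radius $r>0$; $|A|$ is the Lebesgue measure of $A$; $E^{o}$ is the interior of $E$; $\mathbb{1}_A$ is the characteristic function of $A$. Intervals. A closed non-degenerate interval in $\mathbb{R}^m$ is a set $\prod_{j=1}^m[a_j,b_j]$ with $-\infty<a_j<b_j<+\infty$ for all $j$. $\mathcal{I}$ is the family of all of them, and $\mathcal{I}_E$ is the family of those contained in $E$. Intervals $I,J$ are non-overlapping if $I^{o}\cap J^{o}=\emptyset$. A function $F:\mathcal{I}_E\to X$ is an additive interval function if $F(I\cup J)=F(I)+F(J)$ whenever $I,J\in\mathcal{I}_E$ are non-overlapping and $I\cup J\in\mathcal{I}_E$. Partitions. An $\mathcal{M}$-partition in $E$ is a finite collection of pairs $(t_i,I_i)$, $i=1,\dots,p$, with $t_i\in E$, $I_i\in\mathcal{I}_E$ and the $I_i$ pairwise non-overlapping (it is not required that $t_i\in I_i$). It is an $\mathcal{M}$-partition of $E$ if also $\bigcup_i I_i=E$. It is $Z$-tagged if all $t_i\in Z$. A gauge on $Z$ is a function $\delta:Z\to(0,+\infty)$; a partition with tags in the domain of $\delta$ is $\delta$-fine if $I_i\subset B_m(t_i,\delta(t_i))$ for all $i$. McShane integral. For $W\in\mathcal{I}$, $f:W\to X$ is McShane integrable on $W$ if there is $x_f\in X$ such that for every $\varepsilon>0$ there is a gauge $\delta$ on $W$ with $\|\sum_{(t,I)\in\pi}f(t)|I|-x_f\|<\varepsilon$ for every $\delta$-fine $\mathcal{M}$-partition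 $\pi$ of $W$; then $(M)\int_W f\,d\lambda=x_f$. In this case $f\cdot\mathbb{1}_A$ is McShane integrable on $W$ for every Lebesgue measurable $A\subset W$, with integral denoted $(M)\int_A f\,d\lambda$, and the primitive of $f$ is the additive interval function $\mathcal{I}_W\to X$, $I\mapsto (M)\int_I f\,d\lambda$. Divisions. Let $E\subset\mathbb{R}^m$ be bounded and Lebesgue measurable with $E^{o}\neq\emptyset$. $\mathscr{P}_E$ is the family of all divisions in $E$, i.e. sequences $(I_k)_{k\ge1}$ of pairwise non-overlapping intervals in $\mathcal{I}_E$. $\mathscr{D}_E$ is the family of all divisions of $E$, i.e. those $(I_k)\in\mathscr{P}_E$ with $E=\bigcup_{k=1}^{\infty}I_k$. (The same notation is used for $E^{o}$.) Dunford-function. An additive interval function $F:\mathcal{I}_E\to X$ is a Dunford-function if for every $(I_k)\in\mathscr{P}_E$: (a) the series $\sum_{k:|I\cap I_k|>0}F(I\cap I_k)$ is unconditionally convergent in $X$ for each $I\in\mathcal{I}$; and (b) if $(I_k)\in\mathscr{D}_{E^{o}}$, then $F(I)=\sum_{k:|I\cap I_k|>0}F(I\cap I_k)$ for all $I\in\mathcal{I}_E$. Negligible variation. An additive interval function $F:\mathcal{I}_E\to X$ has $\mathcal{M}$-negligible variation over $Z\subset\mathbb{R}^m$ if for each $\varepsilon>0$ there is a gauge $\delta_\varepsilon$ on $Z$ such that for each $Z$-tagged $\delta_\varepsilon$-fine $\mathcal{M}$-partition $\pi$ in $\mathbb{R}^m$ and every $(I_k)\in\mathscr{D}_{E^{o}}$: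 the series $\sum_{k:|I\cap I_k|>0}F(I\cap I_k)$ is unconditionally convergent in $X$ for each $(t,I)\in\pi$, and $\big\|\sum_{(t,I)\in\pi}\big(\sum_{k:|I\cap I_k|>0}F(I\cap I_k)\big)\big\|<\varepsilon$. $F$ has $\mathcal{M}$-negligible variation outside of $E^{o}$ if it has $\mathcal{M}$-negligible variation over $\mathbb{R}^m\setminus E^{o}$. Dunford-McShane integral. $f:E\to X$ is Dunford-McShane integrable on $E$ with the primitive $F:\mathcal{I}_E\to X$ if: for each $\varepsilon>0$ there is a gauge $\delta_\varepsilon$ on $E^{o}$ such that $\|\sum_{(t,I)\in\pi}(f(t)|I|-F(I))\|<\varepsilon$ for each $\delta_\varepsilon$-fine $\mathcal{M}$-partition $\pi$ in $E^{o}$; $F$ is a Dunford-function; and $F$ has $\mathcal{M}$-negligible variation outside of $E^{o}$. *)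

theory Defs
  imports "HOL-Analysis.Analysis"
begin

text \<open>
  Functions on a subset of \<open>\<real>\<^sup>m\<close>, interval functions and gauges are total HOL functions of which
  only the values on the intended domain are ever used.
\<close>

definition max_ball :: "real^'m \<Rightarrow> real \<Rightarrow> (real^'m) set" where
  "max_ball t r = {x. infnorm (x - t) < r}"

definition nondeg_intervals :: "(real^'m) set set" where
  "nondeg_intervals = {cbox a b | a b. \<forall>j. a $ j < b $ j}"

definition intervals_in :: "(real^'m) set \<Rightarrow> (real^'m) set set" where
  "intervals_in E = {I \<in> nondeg_intervals. I \<subseteq> E}"

definition nonoverlapping :: "(real^'m) set \<Rightarrow> (real^'m) set \<Rightarrow> bool" where
  "nonoverlapping I J \<longleftrightarrow> interior I \<inter> interior J = {}"

definition additive_interval_fun ::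
  "((real^'m) set \<Rightarrow> 'x::real_normed_vector) \<Rightarrow> (real^'m) set \<Rightarrow> bool" where
  "additive_interval_fun F E \<longleftrightarrow>
     (\<forall>I \<in> intervals_in E. \<forall>J \<in> intervals_in E.
        nonoverlapping I J \<and> I \<union> J \<in> intervals_in E \<longrightarrow> F (I \<union> J) = F I + F J)"

text \<open>
  A set of pairs suffices to represent the finite collections \<open>(t\<^sub>i, I\<^sub>i)\<close>: the \<open>I\<^sub>i\<close> have nonempty
  interior and do not overlap, so no pair can be repeated. Tags need not lie in their intervals.
\<close>

definition M_partition_in ::
  "((real^'m) \<times> (real^'m) set) set \<Rightarrow> (real^'m) set \<Rightarrow> bool" where
  "M_partition_in \<pi> E \<longleftrightarrow>
     finite \<pi> \<and> (\<forall>(t, I) \<in> \<pi>. t \<in> E \<and> I \<in> intervals_in E) \<and>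
     (\<forall>p \<in> \<pi>. \<forall>q \<in> \<pi>. p \<noteq> q \<longrightarrow> nonoverlapping (snd p) (snd q))"

definition M_partition_of ::
  "((real^'m) \<times> (real^'m) set) set \<Rightarrow> (real^'m) set \<Rightarrow> bool" where
  "M_partition_of \<pi> E \<longleftrightarrow> M_partition_in \<pi> E \<and> (\<Union>(t, I) \<in> \<pi>. I) = E"

definition tagged_in ::
  "(real^'m) set \<Rightarrow> ((real^'m) \<times> (real^'m) set) set \<Rightarrow> bool" where
  "tagged_in Z \<pi> \<longleftrightarrow> (\<forall>(t, I) \<in> \<pi>. t \<in> Z)"

definition gauge_on :: "(real^'m) set \<Rightarrow> (real^'m \<Rightarrow> real) \<Rightarrow> bool" where
  "gauge_on Z \<delta> \<longleftrightarrow> (\<forall>t \<in> Z. \<delta> t > 0)"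

definition fine_partition ::
  "(real^'m \<Rightarrow> real) \<Rightarrow> ((real^'m) \<times> (real^'m) set) set \<Rightarrow> bool" where
  "fine_partition \<delta> \<pi> \<longleftrightarrow> (\<forall>(t, I) \<in> \<pi>. I \<subseteq> max_ball t (\<delta> t))"

definition has_mcshane_integral ::
  "(real^'m \<Rightarrow> 'x::real_normed_vector) \<Rightarrow> 'x \<Rightarrow> (real^'m) set \<Rightarrow> bool" where
  "has_mcshane_integral f x W \<longleftrightarrow>
     (\<forall>\<epsilon>>0. \<exists>\<delta>. gauge_on W \<delta> \<and>
        (\<forall>\<pi>. M_partition_of \<pi> W \<and> fine_partition \<delta> \<pi> \<longrightarrow>
           norm ((\<Sum>(t, I) \<in> \<pi>. measure lebesgue I *\<^sub>R f t) - x) < \<epsilon>))"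

definition mcshane_integrable_on ::
  "(real^'m \<Rightarrow> 'x::real_normed_vector) \<Rightarrow> (real^'m) set \<Rightarrow> bool" where
  "mcshane_integrable_on f W \<longleftrightarrow> (\<exists>x. has_mcshane_integral f x W)"

text \<open>
  The integral of \<open>f\<close> over a measurable \<open>A \<subseteq> W\<close> is the integral over \<open>W\<close> of \<open>f\<close> times the
  characteristic function of \<open>A\<close>; the primitive sends \<open>I\<close> to the integral over \<open>I\<close>.
\<close>

definition mcshane_integrable_with_primitive ::
  "(real^'m \<Rightarrow> 'x::real_normed_vector) \<Rightarrow> (real^'m) set \<Rightarrow> ((real^'m) set \<Rightarrow> 'x) \<Rightarrow> bool" where
  "mcshane_integrable_with_primitive f W F \<longleftrightarrow>
     mcshane_integrable_on f W \<and>
     (\<forall>I \<in> intervals_in W. has_mcshane_integral (\<lambda>t. indicat_real I t *\<^sub>R f t) (F I) W)"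

definition divisions_in :: "(real^'m) set \<Rightarrow> (nat \<Rightarrow> (real^'m) set) set" where
  "divisions_in E =
     {D. (\<forall>k. D k \<in> intervals_in E) \<and> (\<forall>j k. j \<noteq> k \<longrightarrow> nonoverlapping (D j) (D k))}"

definition divisions_of :: "(real^'m) set \<Rightarrow> (nat \<Rightarrow> (real^'m) set) set" where
  "divisions_of E = {D \<in> divisions_in E. (\<Union>k. D k) = E}"

definition meeting_indices :: "(real^'m) set \<Rightarrow> (nat \<Rightarrow> (real^'m) set) \<Rightarrow> nat set" where
  "meeting_indices I D = {k. measure lebesgue (I \<inter> D k) > 0}"

text \<open>
  Unconditional convergence of a series is rendered by the order-free \<^const>\<open>summable_on\<close>. If
  \<open>I \<inter> D k\<close> has positive measure, it is itself a non-degenerate interval contained in \<open>D k\<close>.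
\<close>

definition dunford_function ::
  "((real^'m) set \<Rightarrow> 'x::real_normed_vector) \<Rightarrow> (real^'m) set \<Rightarrow> bool" where
  "dunford_function F E \<longleftrightarrow>
     additive_interval_fun F E \<and>
     (\<forall>D \<in> divisions_in E.
        (\<forall>I \<in> nondeg_intervals. (\<lambda>k. F (I \<inter> D k)) summable_on meeting_indices I D) \<and>
        (D \<in> divisions_of (interior E) \<longrightarrow>
           (\<forall>I \<in> intervals_in E. F I = (\<Sum>\<^sub>\<infinity>k \<in> meeting_indices I D. F (I \<inter> D k)))))"

definition M_negligible_variation_over ::
  "((real^'m) set \<Rightarrow> 'x::real_normed_vector) \<Rightarrow> (real^'m) set \<Rightarrow> (real^'m) set \<Rightarrow> bool" where
  "M_negligible_variation_over F E Z \<longleftrightarrow>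
     additive_interval_fun F E \<and>
     (\<forall>\<epsilon>>0. \<exists>\<delta>. gauge_on Z \<delta> \<and>
        (\<forall>\<pi>. M_partition_in \<pi> UNIV \<and> tagged_in Z \<pi> \<and> fine_partition \<delta> \<pi> \<longrightarrow>
           (\<forall>D \<in> divisions_of (interior E).
              (\<forall>(t, I) \<in> \<pi>. (\<lambda>k. F (I \<inter> D k)) summable_on meeting_indices I D) \<and>
              norm (\<Sum>(t, I) \<in> \<pi>. \<Sum>\<^sub>\<infinity>k \<in> meeting_indices I D. F (I \<inter> D k)) < \<epsilon>)))"

definition M_negligible_variation_outside_interior ::
  "((real^'m) set \<Rightarrow> 'x::real_normed_vector) \<Rightarrow> (real^'m) set \<Rightarrow> bool" where
  "M_negligible_variation_outside_interior F E \<longleftrightarrow>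
     M_negligible_variation_over F E (- interior E)"

definition dunford_mcshane_integrable_with_primitive ::
  "(real^'m \<Rightarrow> 'x::real_normed_vector) \<Rightarrow> (real^'m) set \<Rightarrow> ((real^'m) set \<Rightarrow> 'x) \<Rightarrow> bool" where
  "dunford_mcshane_integrable_with_primitive f E F \<longleftrightarrow>
     (\<forall>\<epsilon>>0. \<exists>\<delta>. gauge_on (interior E) \<delta> \<and>
        (\<forall>\<pi>. M_partition_in \<pi> (interior E) \<and> fine_partition \<delta> \<pi> \<longrightarrow>
           norm (\<Sum>(t, I) \<in> \<pi>. measure lebesgue I *\<^sub>R f t - F I) < \<epsilon>)) \<and>
     dunford_function F E \<and>
     M_negligible_variation_outside_interior F E"

end

theory Submission
  imports Defs
begin

text \<open>
  Write \<open>U\<close> for the interior of \<open>G\<close>. The first clause of Dunford-McShane integrability is the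
  Saks-Henstock property of \<open>(f, F)\<close> on \<open>U\<close>, and on an interval \<open>W\<close> the same property, for an
  additive \<open>F\<close>, is equivalent to McShane integrability with primitive \<open>F\<close>.

  From (i) to (ii), fix a division \<open>D\<close> of \<open>U\<close> and put \<open>F0 I = (\<Sum>k. F (I \<inter> D k))\<close>. In a fine
  partition of the large interval the pairs tagged in \<open>U\<close> are controlled by the Saks-Henstock
  property of \<open>F\<close> and all others by the negligible variation.

  From (ii) to (iii), tags need not lie in their intervals, so intersecting a family of intervals
  with one fixed fine partition bounds \<open>F0\<close> on that family. When \<open>f0\<close> vanishes off \<open>U\<close> the bound
  depends only on the measure of the part of the family inside \<open>U\<close>. This yields the convergence of
  all the series, and identifies their sums.

  From (iii) to (i), \<open>U\<close> is the union of the interiors of countably many intervals inside \<open>U\<close>, each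
  of which is a member of some division of \<open>U\<close>. The tags are distributed over these intervals, with
  error \<open>\<epsilon> / 2 ^ (n + 2)\<close> on the \<open>n\<close>-th.
\<close>

subsection \<open>Intervals and additive interval functions\<close>

text \<open>The boundary of \<open>U\<close> may have positive measure, so for an interval
  \<open>I\<close> that leaves \<open>U\<close> the part of \<open>I\<close> not covered by finitely
  many members of a division of \<open>U\<close> need not be small in measure. Ordinary absolute
  continuity therefore cannot identify the sum of the series. Two choices replace it. First
  \<open>f0\<close> is changed on the null set \<open>G - U\<close>, so that it vanishes off the
  open set \<open>U\<close>. Then the gauge keeps every interval tagged in \<open>U\<close> inside
  \<open>U\<close>. Whatever remains of \<open>I\<close> outside \<open>U\<close> thereby becomes
  harmless, however large it is.

  The Saks-Henstock property has the norm outside the sum, and in a general Banach space it does not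
  bound the sum of the norms. Estimates are therefore made for whole subpartitions, which inherit
  the property; tags are grouped before any norm is taken.

  A gauge cannot separate inside from outside at the boundary of an interval. Such points are
  removed by changing the function on a null set, which \<open>null_tagged_gauge\<close> permits for
  arbitrary, possibly non-measurable, functions.\<close>

definition is_box :: "(real^'m) set \<Rightarrow> bool" where
  "is_box I \<longleftrightarrow> (\<exists>a b. I = cbox a b)"

lemma is_box_cbox [simp]: "is_box (cbox a b)"
  unfolding is_box_def by blast

lemma is_boxE:
  assumes "is_box I" obtains a b where "I = cbox a b"
  using assms unfolding is_box_def by blast

lemma is_box_Int: "is_box I \<Longrightarrow> is_box J \<Longrightarrow> is_box (I \<inter> J)"
  unfolding is_box_def by (elim exE) (simp only: Int_interval, blast)

lemma is_box_lmeasurable: "is_box I \<Longrightarrow> I \<in> lmeasurable"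
  by (auto elim: is_boxE)

lemma nondeg_intervals_iff:
  fixes I :: "(real^'m) set"
  shows "I \<in> nondeg_intervals \<longleftrightarrow> is_box I \<and> interior I \<noteq> {}"
proof -
  have eq: "(\<forall>j. a $ j < b $ j) \<longleftrightarrow> interior (cbox a b) \<noteq> {}" for a b :: "real^'m"
    using interval_ne_empty_cart(2) interior_cbox by metis
  show ?thesis unfolding nondeg_intervals_def is_box_def mem_Collect_eq eq by metis
qed

lemma nondeg_is_box: "I \<in> nondeg_intervals \<Longrightarrow> is_box I"
  by (simp add: nondeg_intervals_iff)

lemma is_box_nondeg_iff:
  fixes I :: "(real^'m) set"
  assumes "is_box I"
  shows "I \<in> nondeg_intervals \<longleftrightarrow> measure lebesgue I > 0"
proof -
  obtain a b where I: "I = cbox a b" using assms by (rule is_boxE)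
  have "measure lebesgue (cbox a b) = measure lborel (cbox a b)" by simp
  then show ?thesis
    using content_eq_0_interior[of a b] measure_nonneg[of lborel "cbox a b"] nondeg_intervals_iff
    unfolding I by (metis is_box_cbox less_le)
qed

lemma is_box_measure_0_iff:
  "is_box I \<Longrightarrow> measure lebesgue I = 0 \<longleftrightarrow> I \<notin> nondeg_intervals"
  using is_box_nondeg_iff[of I] measure_nonneg[of lebesgue I] by (simp add: less_le)

lemma is_box_content_0_iff:
  "is_box I \<Longrightarrow> measure lborel I = 0 \<longleftrightarrow> I \<notin> nondeg_intervals"
  using is_box_measure_0_iff[of I] by (auto elim!: is_boxE)

lemma meeting_indices_eq:
  fixes I :: "(real^'m) set"
  assumes "is_box I" "\<And>k. is_box (D k)"
  shows "meeting_indices I D = {k. I \<inter> D k \<in> nondeg_intervals}"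
  unfolding meeting_indices_def using is_box_nondeg_iff is_box_Int assms by blast

definition nondeg_ext :: "((real^'m) set \<Rightarrow> 'x::real_normed_vector) \<Rightarrow> (real^'m) set \<Rightarrow> 'x" where
  "nondeg_ext F I = (if I \<in> nondeg_intervals then F I else 0)"

text \<open>Values of \<open>F\<close> outside the non-degenerate intervals are junk; \<open>nondeg_ext\<close> makes them 0, so that
  \<open>I \<mapsto> nondeg_ext F (I \<inter> B)\<close> is \<open>operative\<close> and sums over \<open>meeting_indices\<close> become sums
  over \<open>UNIV\<close>.\<close>

lemma nondeg_ext_split:
  fixes F :: "(real^'m) set \<Rightarrow> 'x::real_normed_vector"
  assumes F: "additive_interval_fun F W" and sub: "cbox u v \<subseteq> W" and k: "k \<in> Basis"
  shows "nondeg_ext F (cbox u v) =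
    nondeg_ext F (cbox u v \<inter> {x. x \<bullet> k \<le> c}) + nondeg_ext F (cbox u v \<inter> {x. c \<le> x \<bullet> k})"
proof -
  define L where "L = cbox u v \<inter> {x. x \<bullet> k \<le> c}"
  define R where "R = cbox u v \<inter> {x. c \<le> x \<bullet> k}"
  have box: "is_box L" "is_box R"
    unfolding L_def R_def interval_split[OF k] by simp_all
  have un: "L \<union> R = cbox u v" unfolding L_def R_def by auto
  have iL: "interior L = box u v \<inter> {x. x \<bullet> k < c}" 
    unfolding L_def interior_Int using nonzero_Basis[OF k] interior_halfspace_le[of k c] by (auto simp: inner_commute)
  have iR: "interior R = box u v \<inter> {x. c < x \<bullet> k}" 
    unfolding R_def interior_Int using nonzero_Basis[OF k] interior_halfspace_ge[of k c] by (auto simp: inner_commute)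
  have "nondeg_ext F (cbox u v) = nondeg_ext F L + nondeg_ext F R"
  proof (cases "box u v = {}")
    case True
    then show ?thesis using iL iR by (simp add: nondeg_ext_def nondeg_intervals_iff)
  next
    case ne: False
    \<comment> \<open>If one half is flat, the other is the entire box: an open box inside a closed
      half-space takes its closure along. Additivity of \<open>F\<close> itself applies only when
      both halves are solid.\<close>
    consider "interior L = {}" | "interior R = {}" | "interior L \<noteq> {}" "interior R \<noteq> {}" by blast
    then show ?thesis
    proof cases
      case 1
      then have "box u v \<subseteq> {x. c \<le> x \<bullet> k}" using iL by auto
      then have "closure (box u v) \<subseteq> {x. c \<le> x \<bullet> k}"
        by (rule closure_minimal) (simp add: closed_halfspace_component_ge)
      then have "R = cbox u v" using ne by (auto simp: R_def closure_box)
      then show ?thesis using 1 by (simp add: nondeg_ext_def nondeg_intervals_iff)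
    next
      case 2
      then have "box u v \<subseteq> {x. x \<bullet> k \<le> c}" using iR by auto
      then have "closure (box u v) \<subseteq> {x. x \<bullet> k \<le> c}"
        by (rule closure_minimal) (simp add: closed_halfspace_component_le)
      then have "L = cbox u v" using ne by (auto simp: L_def closure_box)
      then show ?thesis using 2 by (simp add: nondeg_ext_def nondeg_intervals_iff)
    next
      case 3
      have n: "L \<in> nondeg_intervals" "R \<in> nondeg_intervals" "cbox u v \<in> nondeg_intervals"
        using 3 box ne by (auto simp: nondeg_intervals_iff)
      have "nonoverlapping L R" unfolding nonoverlapping_def iL iR by auto
      moreover have "L \<in> intervals_in W" "R \<in> intervals_in W" "L \<union> R \<in> intervals_in W"
        using n un sub by (auto simp: intervals_in_def)
      ultimately have "F (L \<union> R) = F L + F R"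
        using F unfolding additive_interval_fun_def by blast
      then show ?thesis using n un by (simp add: nondeg_ext_def)
    qed
  qed
  then show ?thesis by (simp add: L_def R_def)
qed

text \<open>Additivity of \<open>F\<close> concerns two intervals whose union is again an interval,
  whereas the pieces of a general division cannot always be merged pairwise. The locale
  \<open>operative\<close> bridges this gap. It wants a function on all boxes, so every box is first
  intersected with \<open>B\<close>, which keeps it inside \<open>W\<close>.\<close>

lemma additive_interval_fun_division:
  fixes F :: "(real^'m) set \<Rightarrow> 'x::real_normed_vector"
  assumes F: "additive_interval_fun F W" and p: "p division_of B" and sub: "B \<subseteq> W"
    and B: "is_box B"
  shows "(\<Sum>K\<in>p. nondeg_ext F K) = nondeg_ext F B"
proof -
  obtain a b where ab: "B = cbox a b" using B by (rule is_boxE)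
  interpret operative plus 0 "\<lambda>J. nondeg_ext F (J \<inter> B)"
  proof
    fix c d :: "real^'m"
    assume "box c d = {}"
    then show "nondeg_ext F (cbox c d \<inter> B) = 0"
      by (simp add: nondeg_ext_def nondeg_intervals_iff)
  next
    fix c d k :: "real^'m" and e
    assume k: "k \<in> Basis"
    obtain u v where uv: "cbox c d \<inter> B = cbox u v"
      using is_box_Int[of "cbox c d" B] B by (auto elim: is_boxE)
    show "nondeg_ext F (cbox c d \<inter> B) = nondeg_ext F (cbox c d \<inter> {x. x \<bullet> k \<le> e} \<inter> B) +
        nondeg_ext F (cbox c d \<inter> {x. e \<le> x \<bullet> k} \<inter> B)"
    proof -
      have "cbox u v \<subseteq> W" using uv sub by blast
      moreover have "cbox c d \<inter> {x. x \<bullet> k \<le> e} \<inter> B = cbox u v \<inter> {x. x \<bullet> k \<le> e}"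
        "cbox c d \<inter> {x. e \<le> x \<bullet> k} \<inter> B = cbox u v \<inter> {x. e \<le> x \<bullet> k}"
        using uv by auto
      ultimately show ?thesis using nondeg_ext_split[OF F _ k, of u v e] uv by simp
    qed
  qed
  have "(\<Sum>K\<in>p. nondeg_ext F K) = (\<Sum>K\<in>p. nondeg_ext F (K \<inter> B))"
    using division_ofD(2)[OF p] by (intro sum.cong) (auto simp: Int_absorb2)
  also have "\<dots> = nondeg_ext F (B \<inter> B)" using division p unfolding ab sum_def by blast
  finally show ?thesis by simp
qed

section \<open>Partitions from indexed families\<close>

text \<open>Families arise by intersecting intervals with one another, so members may be flat or
  even coincide as flat sets. Only the non-degenerate ones are kept; on these the map from indices
  to pairs is injective as soon as the members do not overlap.\<close>

definition family_partition ::
  "('a \<Rightarrow> real^'m) \<Rightarrow> ('a \<Rightarrow> (real^'m) set) \<Rightarrow> 'a set \<Rightarrow> ((real^'m) \<times> (real^'m) set) set" where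
  "family_partition t K A = (\<lambda>a. (t a, K a)) ` {a \<in> A. K a \<in> nondeg_intervals}"

lemma nonoverlapping_subset:
  "nonoverlapping I J \<Longrightarrow> I' \<subseteq> I \<Longrightarrow> J' \<subseteq> J \<Longrightarrow> nonoverlapping I' J'"
  unfolding nonoverlapping_def using interior_mono by blast

lemma nondeg_self_overlap: "I \<in> nondeg_intervals \<Longrightarrow> \<not> nonoverlapping I I"
  by (simp add: nonoverlapping_def nondeg_intervals_iff)

lemma family_partition_inj:
  assumes "\<And>a b. a \<in> A \<Longrightarrow> b \<in> A \<Longrightarrow> a \<noteq> b \<Longrightarrow> nonoverlapping (K a) (K b)"
  shows "inj_on (\<lambda>a. (t a, K a)) {a \<in> A. K a \<in> nondeg_intervals}"
  using assms nondeg_self_overlap by (fastforce simp: inj_on_def)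

lemma M_partition_in_family:
  assumes "finite A" "\<And>a b. a \<in> A \<Longrightarrow> b \<in> A \<Longrightarrow> a \<noteq> b \<Longrightarrow> nonoverlapping (K a) (K b)"
    "\<And>a. a \<in> A \<Longrightarrow> t a \<in> W" "\<And>a. a \<in> A \<Longrightarrow> K a \<subseteq> W"
  shows "M_partition_in (family_partition t K A) W"
  unfolding M_partition_in_def family_partition_def intervals_in_def
  using assms by (auto; metis snd_conv)

lemma fine_family:
  assumes "\<And>a. a \<in> A \<Longrightarrow> K a \<subseteq> max_ball (t a) (\<delta> (t a))"
  shows "fine_partition \<delta> (family_partition t K A)"
  using assms unfolding fine_partition_def family_partition_def by auto

lemma sum_family:
  assumes "finite A" "\<And>a b. a \<in> A \<Longrightarrow> b \<in> A \<Longrightarrow> a \<noteq> b \<Longrightarrow> nonoverlapping (K a) (K b)"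
  shows "sum \<Phi> (family_partition t K A) =
    (\<Sum>a\<in>A. if K a \<in> nondeg_intervals then \<Phi> (t a, K a) else 0)"
proof -
  have "sum \<Phi> (family_partition t K A) = (\<Sum>a\<in>{a \<in> A. K a \<in> nondeg_intervals}. \<Phi> (t a, K a))"
    unfolding family_partition_def
    by (subst sum.reindex[OF family_partition_inj[OF assms(2)]]) (auto simp: o_def)
  then show ?thesis using assms(1) by (simp add: sum.inter_filter)
qed

text \<open>The conclusion of the Saks-Henstock lemma, taken as a property in its own right.
  \<open>W\<close> is arbitrary, so that one notion covers both compact intervals and the open set
  \<open>interior G\<close>, and partitions are in \<open>W\<close> rather than of
  \<open>W\<close>.\<close>

definition henstock_primitive ::
  "(real^'m \<Rightarrow> 'x::real_normed_vector) \<Rightarrow> ((real^'m) set \<Rightarrow> 'x) \<Rightarrow> (real^'m) set \<Rightarrow> bool" where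
  "henstock_primitive f F W \<longleftrightarrow>
     (\<forall>\<epsilon>>0. \<exists>\<delta>. gauge_on W \<delta> \<and>
        (\<forall>\<pi>. M_partition_in \<pi> W \<and> fine_partition \<delta> \<pi> \<longrightarrow>
           norm (\<Sum>(t, I)\<in>\<pi>. measure lebesgue I *\<^sub>R f t - F I) < \<epsilon>))"

text \<open>The form in which the property is applied. Flat members may stay in the sum, because
  both their measure and their value under \<open>nondeg_ext\<close> are 0.\<close>

lemma henstock_primitive_family:
  fixes f :: "real^'m \<Rightarrow> 'x::real_normed_vector"
  assumes "\<forall>\<pi>. M_partition_in \<pi> W \<and> fine_partition \<delta> \<pi> \<longrightarrow>
           norm (\<Sum>(t, I)\<in>\<pi>. measure lebesgue I *\<^sub>R f t - F I) < \<epsilon>"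
    and "finite A" "\<And>a b. a \<in> A \<Longrightarrow> b \<in> A \<Longrightarrow> a \<noteq> b \<Longrightarrow> nonoverlapping (K a) (K b)"
    and "\<And>a. a \<in> A \<Longrightarrow> is_box (K a)"
    and "\<And>a. a \<in> A \<Longrightarrow> t a \<in> W" "\<And>a. a \<in> A \<Longrightarrow> K a \<subseteq> W" "\<And>a. a \<in> A \<Longrightarrow> K a \<subseteq> max_ball (t a) (\<delta> (t a))"
  shows "norm (\<Sum>a\<in>A. measure lebesgue (K a) *\<^sub>R f (t a) - nondeg_ext F (K a)) < \<epsilon>"
proof -
  have "norm (\<Sum>(t, I)\<in>family_partition t K A. measure lebesgue I *\<^sub>R f t - F I) < \<epsilon>"
    using assms(1) M_partition_in_family[of A K t W] fine_family[of A K t \<delta>] assms(2-) by blast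
  also have "(\<Sum>(t, I)\<in>family_partition t K A. measure lebesgue I *\<^sub>R f t - F I) =
      (\<Sum>a\<in>A. measure lebesgue (K a) *\<^sub>R f (t a) - nondeg_ext F (K a))"
  proof (subst sum_family[OF assms(2,3)], assumption+, intro sum.cong refl)
    fix a assume "a \<in> A"
    then have "K a \<notin> nondeg_intervals \<Longrightarrow> measure lebesgue (K a) = 0"
      using is_box_measure_0_iff assms(4) by blast
    then show "(if K a \<in> nondeg_intervals
          then case (t a, K a) of (t, I) \<Rightarrow> measure lebesgue I *\<^sub>R f t - F I else 0) =
        measure lebesgue (K a) *\<^sub>R f (t a) - nondeg_ext F (K a)"
      by (auto simp: nondeg_ext_def)
  qed
  finally show ?thesis .
qed

subsection \<open>Fine partitions\<close>

lemma open_max_ball: "open (max_ball (t::real^'m) r)"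
proof -
  have "continuous_on UNIV (\<lambda>x::real^'m. infnorm (x - t))"
    using continuous_infnorm by (auto simp: continuous_on_eq_continuous_within intro!: continuous_intros)
  then show ?thesis unfolding max_ball_def
    by (intro open_Collect_less) (auto intro: continuous_intros)
qed

lemma centre_in_max_ball: "r > 0 \<Longrightarrow> t \<in> max_ball t r"
  by (simp add: max_ball_def infnorm_0)

lemma max_ball_mono: "r \<le> s \<Longrightarrow> max_ball t r \<subseteq> max_ball t s"
  by (auto simp: max_ball_def)

lemma max_ball_in_open:
  fixes t :: "real^'m"
  assumes "open S" "t \<in> S"
  shows "\<exists>r>0. max_ball t r \<subseteq> S"
proof -
  obtain e where e: "e > 0" "ball t e \<subseteq> S" using assms open_contains_ball by blast
  \<comment> \<open>The constant comparing the Euclidean norm, which defines \<open>ball\<close>,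
    with the maximum norm used by the gauges.\<close>
  define c where "c = sqrt DIM(real^'m)"
  have c: "c > 0" by (simp add: c_def)
  have "max_ball t (e / c) \<subseteq> ball t e"
  proof
    fix x assume "x \<in> max_ball t (e / c)"
    then have "c * infnorm (x - t) < e" using c by (simp add: max_ball_def field_simps)
    then have "norm (x - t) < e" using norm_le_infnorm[of "x - t"] unfolding c_def by linarith
    then show "x \<in> ball t e" by (simp add: dist_norm norm_minus_commute)
  qed
  then show ?thesis using e c by (intro exI[of _ "e / c"]) auto
qed

lemma negligible_Int_nonoverlapping:
  assumes "is_box I" "is_box J" "nonoverlapping I J"
  shows "negligible (I \<inter> J)"
proof -
  obtain a b where ab: "I \<inter> J = cbox a b" using is_box_Int[OF assms(1,2)] by (rule is_boxE)
  have "interior (I \<inter> J) = {}" using assms(3) by (simp add: nonoverlapping_def)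
  then show ?thesis by (metis ab interior_cbox negligible_interval(1))
qed

lemma measure_nonoverlapping_Union:
  fixes K :: "'a \<Rightarrow> (real^'m) set"
  assumes "finite A" "\<And>a. a \<in> A \<Longrightarrow> is_box (K a)"
    "\<And>a b. a \<in> A \<Longrightarrow> b \<in> A \<Longrightarrow> a \<noteq> b \<Longrightarrow> nonoverlapping (K a) (K b)"
  shows "(\<Sum>a\<in>A. measure lebesgue (K a)) = measure lebesgue (\<Union>a\<in>A. K a)"
proof (rule measure_negligible_finite_Union_image[symmetric, OF assms(1)])
  show "K a \<in> lmeasurable" if "a \<in> A" for a using assms(2)[OF that] by (rule is_box_lmeasurable)
  show "pairwise (\<lambda>a b. negligible (K a \<inter> K b)) A"
    unfolding pairwise_def using negligible_Int_nonoverlapping assms(2,3) by blast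
qed

lemma measure_nonoverlapping_le:
  fixes K :: "'a \<Rightarrow> (real^'m) set"
  assumes "finite A" "\<And>a. a \<in> A \<Longrightarrow> is_box (K a)"
    "\<And>a b. a \<in> A \<Longrightarrow> b \<in> A \<Longrightarrow> a \<noteq> b \<Longrightarrow> nonoverlapping (K a) (K b)"
    "\<And>a. a \<in> A \<Longrightarrow> K a \<subseteq> T" "T \<in> lmeasurable"
  shows "(\<Sum>a\<in>A. measure lebesgue (K a)) \<le> measure lebesgue T"
proof -
  have "(\<Union>a\<in>A. K a) \<in> lmeasurable"
    using assms(1,2) by (intro fmeasurable.finite_UN) (auto intro: is_box_lmeasurable)
  then have "measure lebesgue (\<Union>a\<in>A. K a) \<le> measure lebesgue T"
    using assms(4,5) by (intro measure_mono_fmeasurable) (auto dest: fmeasurableD)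
  then show ?thesis using measure_nonoverlapping_Union[OF assms(1-3)] by simp
qed

text \<open>The whole geometric series has sum \<open>\<epsilon> / 2\<close>, so the inequality
  stays strict even when each part is only bounded by \<le>.\<close>

lemma sum_half_powers_less:
  assumes "finite M" "(0::real) < \<epsilon>"
  shows "(\<Sum>n\<in>M. \<epsilon> / 2 ^ (n + 2)) < \<epsilon>"
proof -
  have s: "(\<lambda>n. \<epsilon> / 4 * (1/2) ^ n) sums (\<epsilon> / 4 * (1 / (1 - 1/2)))"
    by (intro sums_mult geometric_sums) simp
  have "(\<Sum>n\<in>M. \<epsilon> / 2 ^ (n + 2)) = (\<Sum>n\<in>M. \<epsilon> / 4 * (1/2) ^ n)"
    by (intro sum.cong) (auto simp: power_add field_simps)
  also have "\<dots> \<le> suminf (\<lambda>n. \<epsilon> / 4 * (1/2) ^ n)"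
    using assms s by (intro sum_le_suminf) (auto simp: sums_iff)
  also have "\<dots> = \<epsilon> / 2" using s by (simp add: sums_iff)
  finally show ?thesis using assms by linarith
qed

lemma M_partition_in_subset:
  "M_partition_in \<pi> W \<Longrightarrow> \<pi>' \<subseteq> \<pi> \<Longrightarrow> M_partition_in \<pi>' W"
  unfolding M_partition_in_def by (meson finite_subset subsetD)

lemma M_partition_in_mono:
  "M_partition_in \<pi> V \<Longrightarrow> V \<subseteq> W \<Longrightarrow> M_partition_in \<pi> W"
  unfolding M_partition_in_def intervals_in_def by fast

lemma fine_partition_subset: "fine_partition \<delta> \<pi> \<Longrightarrow> \<pi>' \<subseteq> \<pi> \<Longrightarrow> fine_partition \<delta> \<pi>'"
  unfolding fine_partition_def by blast

lemma fine_partitionD: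
  "fine_partition \<delta> \<pi> \<Longrightarrow> p \<in> \<pi> \<Longrightarrow> snd p \<subseteq> max_ball (fst p) (\<delta> (fst p))"
  unfolding fine_partition_def by (auto simp: case_prod_beta)

text \<open>The tags are sorted by the size of \<open>f\<close>. On level \<open>k\<close> the norm
  of \<open>f\<close> is at most \<open>k\<close>, and the gauge forces the intervals tagged there
  into an open set \<open>T k\<close> around \<open>N\<close> whose measure is small compared with
  \<open>1 / k\<close>. The intervals do not overlap, so level \<open>k\<close> contributes at most
  \<open>k\<close> times the measure of \<open>T k\<close>.\<close>

lemma null_tagged_gauge:
  fixes f :: "real^'m \<Rightarrow> 'x::real_normed_vector"
  assumes N: "N \<in> null_sets lebesgue" and \<epsilon>: "\<epsilon> > 0"
  shows "\<exists>\<delta>. gauge_on UNIV \<delta> \<and>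
    (\<forall>\<pi>. M_partition_in \<pi> UNIV \<and> tagged_in N \<pi> \<and> fine_partition \<delta> \<pi> \<longrightarrow>
       (\<Sum>(t,I)\<in>\<pi>. measure lebesgue I * norm (f t)) < \<epsilon>)"
proof -
  \<comment> \<open>The factor \<open>real n + 1\<close> absorbs the bound on \<open>f\<close> at
    level \<open>n\<close> and stays positive at level 0; the power of 2 makes the levels
    summable.\<close>
  define e where "e n = \<epsilon> / ((real n + 1) * 2 ^ (n + 2))" for n
  have e: "e n > 0" for n using \<epsilon> by (simp add: e_def)
  have "\<exists>T. open T \<and> N \<subseteq> T \<and> T \<in> lmeasurable \<and> measure lebesgue T < e n" for n
  proof -
    obtain T where T: "open T" "N \<subseteq> T" "T - N \<in> lmeasurable" "emeasure lebesgue (T - N) < ennreal (e n)"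
      using sets_lebesgue_outer_open[of N "e n"] N e by blast
    \<comment> \<open>The outer approximation controls only \<open>T - N\<close>; since
      \<open>N\<close> is null, the bound carries over to \<open>T\<close>.\<close>
    have m: "measure lebesgue (T - N) < e n"
      using T(3,4) e[of n] by (simp add: emeasure_eq_measure2 ennreal_less_iff)
    have Ts: "T \<in> sets lebesgue" using T(1) by simp
    then have eq: "measure lebesgue T = measure lebesgue (T - N)"
        "emeasure lebesgue T = emeasure lebesgue (T - N)"
      using N by (simp_all add: measure_Diff_null_set emeasure_Diff_null_set)
    moreover have "T \<in> lmeasurable"
      using T(3) Ts eq(2) unfolding fmeasurable_def by auto
    ultimately have "T \<in> lmeasurable" "measure lebesgue T = measure lebesgue (T - N)" by auto
    then show ?thesis using T m by auto
  qed
  then obtain T where T: "\<And>n. open (T n)" "\<And>n. N \<subseteq> T n" "\<And>n. T n \<in> lmeasurable"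
    "\<And>n. measure lebesgue (T n) < e n" by metis
  define n where "n t = nat \<lceil>norm (f t)\<rceil>" for t
  have n: "norm (f t) \<le> real (n t)" for t unfolding n_def by linarith
  have "\<exists>r>0. t \<in> N \<longrightarrow> max_ball t r \<subseteq> T (n t)" for t
    using max_ball_in_open[OF T(1), of t "n t"] T(2) zero_less_one by blast
  then obtain \<delta> where \<delta>: "\<And>t. \<delta> t > 0" "\<And>t. t \<in> N \<Longrightarrow> max_ball t (\<delta> t) \<subseteq> T (n t)" by metis
  show ?thesis
  proof (intro exI[of _ \<delta>] conjI allI impI)
    show "gauge_on UNIV \<delta>" using \<delta> by (simp add: gauge_on_def)
    fix \<pi> assume "M_partition_in \<pi> UNIV \<and> tagged_in N \<pi> \<and> fine_partition \<delta> \<pi>"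
    then have \<pi>: "M_partition_in \<pi> UNIV" "tagged_in N \<pi>" "fine_partition \<delta> \<pi>" by auto
    have fin: "finite \<pi>" using \<pi> by (simp add: M_partition_in_def)
    define S where "S k = {p \<in> \<pi>. n (fst p) = k}" for k
    have S: "(\<Sum>p\<in>S k. measure lebesgue (snd p) * norm (f (fst p))) \<le> \<epsilon> / 2 ^ (k + 2)" for k
    proof -
      have "(\<Sum>p\<in>S k. measure lebesgue (snd p) * norm (f (fst p))) 
          \<le> (\<Sum>p\<in>S k. real k * measure lebesgue (snd p))"
      proof (intro sum_mono)
        fix p assume "p \<in> S k"
        then have "norm (f (fst p)) \<le> real k" using n[of "fst p"] by (auto simp: S_def)
        then show "measure lebesgue (snd p) * norm (f (fst p)) \<le> real k * measure lebesgue (snd p)"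
          by (simp add: mult.commute mult_right_mono)
      qed
      also have "\<dots> = real k * (\<Sum>p\<in>S k. measure lebesgue (snd p))" by (simp add: sum_distrib_left)
      also have "\<dots> \<le> real k * measure lebesgue (T k)"
      proof (intro mult_left_mono measure_nonoverlapping_le)
        fix p assume p: "p \<in> S k"
        then show "is_box (snd p)"
          using \<pi>(1) nondeg_is_box by (force simp: S_def M_partition_in_def intervals_in_def)
        have "snd p \<subseteq> max_ball (fst p) (\<delta> (fst p))" "fst p \<in> N"
          using p \<pi>(2,3) by (cases p; auto simp: S_def fine_partition_def tagged_in_def)+
        then show "snd p \<subseteq> T k" using \<delta>(2) p by (force simp: S_def)
      next
        show "finite (S k)" using fin by (simp add: S_def)
        show "nonoverlapping (snd p) (snd q)" if "p \<in> S k" "q \<in> S k" "p \<noteq> q" for p q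
          using that \<pi>(1) by (auto simp: S_def M_partition_in_def)
      qed (use T in auto)
      also have "\<dots> \<le> (real k + 1) * e k"
        using T(4)[of k] by (intro mult_mono) auto
      also have "\<dots> = \<epsilon> / 2 ^ (k + 2)" unfolding e_def
      proof -
        have "c * (\<epsilon> / (c * X)) = \<epsilon> / X" if "c > 0" for c X :: real using that by simp
        then show "(real k + 1) * (\<epsilon> / ((real k + 1) * 2 ^ (k + 2))) = \<epsilon> / 2 ^ (k + 2)" by simp
      qed
      finally show ?thesis .
    qed
    have "(\<Sum>(t,I)\<in>\<pi>. measure lebesgue I * norm (f t)) = 
        (\<Sum>p\<in>\<pi>. measure lebesgue (snd p) * norm (f (fst p)))"
      by (simp add: case_prod_beta)
    also have "\<dots> = (\<Sum>k\<in>(\<lambda>p. n (fst p)) ` \<pi>. \<Sum>p\<in>S k. measure lebesgue (snd p) * norm (f (fst p)))"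
      unfolding S_def by (rule sum.image_gen[OF fin])
    also have "\<dots> \<le> (\<Sum>k\<in>(\<lambda>p. n (fst p)) ` \<pi>. \<epsilon> / 2 ^ (k + 2))" by (intro sum_mono S)
    also have "\<dots> < \<epsilon>" using fin \<epsilon> by (intro sum_half_powers_less) auto
    finally show "(\<Sum>(t,I)\<in>\<pi>. measure lebesgue I * norm (f t)) < \<epsilon>" .
  qed
qed

text \<open>A fine tagged division supplied by the library becomes a McShane partition after its
  flat members are dropped; by \<open>division_of_nontrivial\<close> the others still cover
  \<open>W\<close>.\<close>

lemma cousin:
  fixes W :: "(real^'m) set"
  assumes W: "W \<in> nondeg_intervals" and \<delta>: "gauge_on W \<delta>"
  shows "\<exists>\<pi>. M_partition_of \<pi> W \<and> fine_partition \<delta> \<pi>"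
proof -
  obtain a b where ab: "W = cbox a b" using nondeg_is_box[OF W] by (rule is_boxE)
  \<comment> \<open>A library gauge must be defined at every point, while \<delta> is known to be
    positive only on \<open>W\<close>; \<open>UNIV\<close> is a harmless default elsewhere.\<close>
  define \<gamma> where "\<gamma> x = (if x \<in> W then max_ball x (\<delta> x) else UNIV)" for x
  have "gauge \<gamma>" unfolding gauge_def \<gamma>_def
    using \<delta> by (auto simp: open_max_ball centre_in_max_ball gauge_on_def)
  then obtain p where p: "p tagged_division_of cbox a b" "\<gamma> fine p" using fine_division_exists by blast
  note pD = tagged_division_ofD[OF p(1)]
  define \<pi> where "\<pi> = {q \<in> p. snd q \<in> nondeg_intervals}"
  have "measure lborel (cbox a b) \<noteq> 0" using is_box_content_0_iff[of W] W ab by auto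
  then have "{k \<in> snd ` p. measure lborel k \<noteq> 0} division_of cbox a b"
    by (rule division_of_nontrivial[OF division_of_tagged_division[OF p(1)]])
  moreover have "{k \<in> snd ` p. measure lborel k \<noteq> 0} = snd ` \<pi>"
  proof -
    have "is_box (snd q)" if "q \<in> p" for q
      using pD(4)[of "fst q" "snd q"] that by (auto simp: is_box_def)
    then show ?thesis unfolding \<pi>_def using is_box_content_0_iff by auto
  qed
  ultimately have "\<Union> (snd ` \<pi>) = W" using ab division_ofD(6) by auto
  moreover have "M_partition_in \<pi> W"
    unfolding M_partition_in_def
  proof (intro conjI ballI impI)
    show "finite \<pi>" using pD(1) by (simp add: \<pi>_def)
    fix q :: "(real^'m) \<times> (real^'m) set" assume q: "q \<in> \<pi>"
    show "case q of (t, I) \<Rightarrow> t \<in> W \<and> I \<in> intervals_in W"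
      using q pD(2,3)[of "fst q" "snd q"] unfolding \<pi>_def intervals_in_def ab by (cases q) auto
    fix q' assume "q' \<in> \<pi>" "q \<noteq> q'"
    then show "nonoverlapping (snd q) (snd q')"
      using q pD(5)[of "fst q" "snd q" "fst q'" "snd q'"] 
      by (auto simp: \<pi>_def nonoverlapping_def prod_eq_iff)
  qed
  moreover have "fine_partition \<delta> \<pi>"
    using p(2) pD(2,3) unfolding fine_partition_def \<pi>_def fine_def \<gamma>_def ab 
    by (fastforce split: if_splits)
  ultimately show ?thesis unfolding M_partition_of_def by (intro exI[of _ \<pi>]) (auto simp: case_prod_beta)
qed

section \<open>Completing a finite family of intervals\<close>

text \<open>The solid members form a division of their union, which extends to a division of
  \<open>B\<close>; \<open>Q\<close> is what has been added, again without flat pieces. Finite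
  partitions and finite parts of series are both completed in this way.\<close>

lemma division_complement:
  fixes B :: "(real^'m) set" and K :: "'a \<Rightarrow> (real^'m) set"
  assumes B: "B \<in> nondeg_intervals" and A: "finite A" "\<And>a. a \<in> A \<Longrightarrow> is_box (K a)"
    "\<And>a b. a \<in> A \<Longrightarrow> b \<in> A \<Longrightarrow> a \<noteq> b \<Longrightarrow> nonoverlapping (K a) (K b)"
    "\<And>a. a \<in> A \<Longrightarrow> K a \<subseteq> B"
  obtains Q where "finite Q" "Q \<subseteq> intervals_in B" "pairwise nonoverlapping Q"
    "\<forall>a\<in>A. \<forall>J\<in>Q. nonoverlapping (K a) J"
    "K ` {a \<in> A. K a \<in> nondeg_intervals} \<union> Q division_of B"
    "K ` {a \<in> A. K a \<in> nondeg_intervals} \<inter> Q = {}"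
proof -
  obtain u v where uv: "B = cbox u v" using nondeg_is_box[OF B] by (rule is_boxE)
  define P where "P = K ` {a \<in> A. K a \<in> nondeg_intervals}"
  have Pdiv: "P division_of \<Union>P"
  proof (rule division_ofI)
    show "finite P" using A by (simp add: P_def)
    show "\<And>k. k \<in> P \<Longrightarrow> k \<noteq> {}" by (auto simp: P_def nondeg_intervals_iff)
    show "\<And>k. k \<in> P \<Longrightarrow> \<exists>a b. k = cbox a b" using A by (auto simp: P_def is_box_def)
    show "\<And>k1 k2. k1 \<in> P \<Longrightarrow> k2 \<in> P \<Longrightarrow> k1 \<noteq> k2 \<Longrightarrow> interior k1 \<inter> interior k2 = {}"
      using A(3) unfolding P_def nonoverlapping_def by blast
  qed auto
  have "\<Union>P \<subseteq> cbox u v" using A(4) uv by (auto simp: P_def)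
  then obtain q where q: "P \<subseteq> q" "q division_of cbox u v"
    using partial_division_extend_interval[OF Pdiv] by blast
  have "measure lborel (cbox u v) \<noteq> 0" 
    using is_box_content_0_iff[of B] B uv by auto
  then have q1: "{k \<in> q. measure lborel k \<noteq> 0} division_of cbox u v"
    by (rule division_of_nontrivial[OF q(2)])
  have eq: "{k \<in> q. measure lborel k \<noteq> 0} = {k \<in> q. k \<in> nondeg_intervals}"
  proof -
    have "is_box k" if "k \<in> q" for k
      unfolding is_box_def by (rule division_ofD(4)[OF q(2) that])
    then have "\<And>k. k \<in> q \<Longrightarrow> measure lborel k \<noteq> 0 \<longleftrightarrow> k \<in> nondeg_intervals"
      using is_box_content_0_iff by blast
    then show ?thesis by blast
  qed
  \<comment> \<open>Removing \<open>P\<close> makes the two collections disjoint as sets, so that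
    sums over the division split.\<close>
  define Q where "Q = {k \<in> q. k \<in> nondeg_intervals} - P"
  have PQ: "P \<union> Q = {k \<in> q. k \<in> nondeg_intervals}" using q(1) by (auto simp: Q_def P_def)
  note d = q1[unfolded eq, folded PQ uv]
  show thesis
  proof (rule that[of Q])
    show "finite Q" using division_ofD(1)[OF d] by simp
    show "Q \<subseteq> intervals_in B" using division_ofD(2)[OF d] by (auto simp: Q_def intervals_in_def)
    show "pairwise nonoverlapping Q" 
      using division_ofD(5)[OF d] by (auto simp: pairwise_def nonoverlapping_def)
    have "nonoverlapping (K a) J" if "a \<in> A" "J \<in> Q" for a J
    proof (cases "K a \<in> nondeg_intervals")
      case True
      then have "K a \<in> P" using that by (simp add: P_def)
      then show ?thesis using division_ofD(5)[OF d, of "K a" J] that 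
        by (auto simp: nonoverlapping_def Q_def)
    next
      case False
      then show ?thesis using A(2)[OF that(1)] by (auto simp: nonoverlapping_def nondeg_intervals_iff)
    qed
    then show "\<forall>a\<in>A. \<forall>J\<in>Q. nonoverlapping (K a) J" by blast
    show "K ` {a \<in> A. K a \<in> nondeg_intervals} \<union> Q division_of B" using d by (simp add: P_def)
    show "K ` {a \<in> A. K a \<in> nondeg_intervals} \<inter> Q = {}" by (auto simp: Q_def P_def)
  qed
qed

text \<open>Divisions are sets, families are indexed. Two indices with the same image must have a
  flat image, and flat images contribute 0.\<close>

lemma sum_image_nondeg:
  fixes K :: "'a \<Rightarrow> (real^'m) set"
  assumes A: "finite A" 
    "\<And>a b. a \<in> A \<Longrightarrow> b \<in> A \<Longrightarrow> a \<noteq> b \<Longrightarrow> nonoverlapping (K a) (K b)"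
  shows "(\<Sum>k\<in>K ` {a \<in> A. K a \<in> nondeg_intervals}. nondeg_ext F k) = (\<Sum>a\<in>A. nondeg_ext F (K a))"
proof -
  have "inj_on K {a \<in> A. K a \<in> nondeg_intervals}"
    using A(2) nondeg_self_overlap by (fastforce simp: inj_on_def)
  then have "(\<Sum>k\<in>K ` {a \<in> A. K a \<in> nondeg_intervals}. nondeg_ext F k) = 
    (\<Sum>a\<in>{a \<in> A. K a \<in> nondeg_intervals}. nondeg_ext F (K a))" by (simp add: sum.reindex)
  also have "\<dots> = (\<Sum>a\<in>A. nondeg_ext F (K a))"
    using A(1) by (intro sum.mono_neutral_left) (auto simp: nondeg_ext_def)
  finally show ?thesis .
qed

text \<open>Read backwards, the sum of \<open>F\<close> over \<open>Q\<close> is the error made when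
  \<open>F B\<close> is replaced by the sum over the family; this is the remainder to be estimated
  for a series.\<close>

lemma additive_complement:
  fixes B :: "(real^'m) set" and K :: "'a \<Rightarrow> (real^'m) set"
    and F :: "(real^'m) set \<Rightarrow> 'x::real_normed_vector"
  assumes F: "additive_interval_fun F W" and B: "B \<subseteq> W" "is_box B"
    and A: "finite A" "\<And>a b. a \<in> A \<Longrightarrow> b \<in> A \<Longrightarrow> a \<noteq> b \<Longrightarrow> nonoverlapping (K a) (K b)"
    and Q: "K ` {a \<in> A. K a \<in> nondeg_intervals} \<union> Q division_of B" 
      "K ` {a \<in> A. K a \<in> nondeg_intervals} \<inter> Q = {}" "Q \<subseteq> nondeg_intervals"
  shows "nondeg_ext F B = (\<Sum>a\<in>A. nondeg_ext F (K a)) + (\<Sum>J\<in>Q. F J)"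
proof -
  have fin: "finite Q" using division_ofD(1)[OF Q(1)] by simp
  have "nondeg_ext F B = (\<Sum>k\<in>K ` {a \<in> A. K a \<in> nondeg_intervals} \<union> Q. nondeg_ext F k)"
    using additive_interval_fun_division[OF F Q(1) B] by simp
  also have "\<dots> = (\<Sum>a\<in>A. nondeg_ext F (K a)) + (\<Sum>k\<in>Q. nondeg_ext F k)"
    using A fin Q(2) by (subst sum.union_disjoint) (auto simp: sum_image_nondeg)
  also have "(\<Sum>k\<in>Q. nondeg_ext F k) = (\<Sum>k\<in>Q. F k)"
    using Q(3) by (intro sum.cong) (auto simp: nondeg_ext_def)
  finally show ?thesis .
qed

text \<open>If the family covers \<open>B\<close>, the complement \<open>Q\<close> is empty: a
  member of \<open>Q\<close> would be a finite union of its negligible intersections with the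
  \<open>K a\<close>, yet has positive measure.\<close>

lemma additive_family:
  fixes B :: "(real^'m) set" and K :: "'a \<Rightarrow> (real^'m) set"
    and F :: "(real^'m) set \<Rightarrow> 'x::real_normed_vector"
  assumes F: "additive_interval_fun F W" and B: "B \<subseteq> W" "B \<in> nondeg_intervals"
    and A: "finite A" "\<And>a. a \<in> A \<Longrightarrow> is_box (K a)"
      "\<And>a b. a \<in> A \<Longrightarrow> b \<in> A \<Longrightarrow> a \<noteq> b \<Longrightarrow> nonoverlapping (K a) (K b)"
    and cover: "(\<Union>a\<in>A. K a) = B"
  shows "(\<Sum>a\<in>A. nondeg_ext F (K a)) = F B"
proof -
  have sub: "\<And>a. a \<in> A \<Longrightarrow> K a \<subseteq> B" using cover by blast
  obtain Q where Q: "finite Q" "Q \<subseteq> intervals_in B" "pairwise nonoverlapping Q"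
    "\<forall>a\<in>A. \<forall>J\<in>Q. nonoverlapping (K a) J"
    "K ` {a \<in> A. K a \<in> nondeg_intervals} \<union> Q division_of B"
    "K ` {a \<in> A. K a \<in> nondeg_intervals} \<inter> Q = {}"
    by (rule division_complement[OF B(2) A sub])
  have "Q = {}"
  proof (rule ccontr)
    assume "Q \<noteq> {}"
    then obtain J where J: "J \<in> Q" by blast
    then have Jn: "J \<in> nondeg_intervals" "J \<subseteq> B" using Q(2) by (auto simp: intervals_in_def)
    then have Jb: "is_box J" using nondeg_is_box by blast
    have "negligible (\<Union>a\<in>A. K a \<inter> J)"
      using A Q(4) J Jb by (intro negligible_Union) (auto intro!: negligible_Int_nonoverlapping)
    moreover have "(\<Union>a\<in>A. K a \<inter> J) = J" using cover Jn by blast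
    ultimately have "measure lebesgue J = 0" by (simp add: negligible_imp_measure0)
    then show False using Jn is_box_measure_0_iff[OF Jb] by auto
  qed
  then show ?thesis 
    using additive_complement[OF F B(1) _ A(1,3) Q(5,6)] B(2) nondeg_is_box[OF B(2)]
    by (auto simp: nondeg_ext_def)
qed

subsection \<open>The McShane integral and the Saks-Henstock property\<close>

abbreviation riemann_sum :: "(real^'m \<Rightarrow> 'x::real_normed_vector) \<Rightarrow> ((real^'m) \<times> (real^'m) set) set \<Rightarrow> 'x" where
  "riemann_sum f \<pi> \<equiv> (\<Sum>(t, I)\<in>\<pi>. measure lebesgue I *\<^sub>R f t)"

lemma norm_diff_less_halves:
  "norm a < \<epsilon> / 2 \<Longrightarrow> norm b < \<epsilon> / 2 \<Longrightarrow> norm (a - b) < \<epsilon>"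
  using norm_triangle_ineq4[of a b] by simp

lemma norm_add_less_halves:
  "norm a < \<epsilon> / 2 \<Longrightarrow> norm b < \<epsilon> / 2 \<Longrightarrow> norm (a + b) < \<epsilon>"
  using norm_triangle_ineq[of a b] by simp

section \<open>Null sets, uniqueness and linearity\<close>

text \<open>Only pairs tagged where \<open>f\<close> and \<open>g\<close> differ contribute to the
  difference, and \<open>null_tagged_gauge\<close> for \<open>f - g\<close> makes even the sum of
  their norms small.\<close>

lemma riemann_sum_null_change:
  fixes f g :: "real^'m \<Rightarrow> 'x::real_normed_vector"
  assumes N: "{t \<in> W. f t \<noteq> g t} \<in> null_sets lebesgue" and \<epsilon>: "\<epsilon> > 0"
  shows "\<exists>\<delta>. gauge_on UNIV \<delta> \<and> (\<forall>\<pi>. M_partition_in \<pi> W \<and> fine_partition \<delta> \<pi> \<longrightarrow>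
    norm (riemann_sum f \<pi> - riemann_sum g \<pi>) < \<epsilon>)"
proof -
  obtain \<delta> where \<delta>: "gauge_on UNIV \<delta>"
    "\<forall>\<pi>. M_partition_in \<pi> UNIV \<and> tagged_in {t \<in> W. f t \<noteq> g t} \<pi> \<and> fine_partition \<delta> \<pi> \<longrightarrow>
       (\<Sum>(t,I)\<in>\<pi>. measure lebesgue I * norm (f t - g t)) < \<epsilon>"
    using null_tagged_gauge[OF N \<epsilon>, of "\<lambda>t. f t - g t"] by blast
  show ?thesis
  proof (intro exI[of _ \<delta>] conjI allI impI)
    show "gauge_on UNIV \<delta>" by (rule \<delta>(1))
    fix \<pi> assume "M_partition_in \<pi> W \<and> fine_partition \<delta> \<pi>"
    then have \<pi>: "M_partition_in \<pi> W" "fine_partition \<delta> \<pi>" by auto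
    define \<pi>' where "\<pi>' = {p \<in> \<pi>. f (fst p) \<noteq> g (fst p)}"
    have sub: "\<pi>' \<subseteq> \<pi>" by (auto simp: \<pi>'_def)
    have "M_partition_in \<pi>' UNIV"
      using M_partition_in_subset[OF \<pi>(1) sub] by (rule M_partition_in_mono) simp
    moreover have "tagged_in {t \<in> W. f t \<noteq> g t} \<pi>'"
      using \<pi>(1) by (auto simp: tagged_in_def \<pi>'_def M_partition_in_def)
    ultimately have less: "(\<Sum>(t,I)\<in>\<pi>'. measure lebesgue I * norm (f t - g t)) < \<epsilon>"
      using \<delta>(2) fine_partition_subset[OF \<pi>(2) sub] by blast
    have fin: "finite \<pi>" using \<pi> by (simp add: M_partition_in_def)
    have "riemann_sum f \<pi> - riemann_sum g \<pi> = (\<Sum>(t,I)\<in>\<pi>. measure lebesgue I *\<^sub>R (f t - g t))"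
      by (simp add: sum_subtractf[symmetric] case_prod_beta scaleR_diff_right)
    also have "\<dots> = (\<Sum>(t,I)\<in>\<pi>'. measure lebesgue I *\<^sub>R (f t - g t))"
      using fin by (intro sum.mono_neutral_right) (auto simp: \<pi>'_def)
    also have "norm \<dots> \<le> (\<Sum>(t,I)\<in>\<pi>'. measure lebesgue I * norm (f t - g t))"
      by (rule order_trans[OF norm_sum]) (simp add: case_prod_beta)
    finally show "norm (riemann_sum f \<pi> - riemann_sum g \<pi>) < \<epsilon>" using less by linarith
  qed
qed

lemma gauge_on_min:
  "gauge_on W \<delta> \<Longrightarrow> gauge_on W \<delta>' \<Longrightarrow> gauge_on W (\<lambda>t. min (\<delta> t) (\<delta>' t))"
  by (simp add: gauge_on_def)

lemma gauge_on_subset: "gauge_on W \<delta> \<Longrightarrow> V \<subseteq> W \<Longrightarrow> gauge_on V \<delta>"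
  by (auto simp: gauge_on_def)

lemma fine_partition_min:
  "fine_partition (\<lambda>t. min (\<delta> t) (\<delta>' t)) \<pi> \<longleftrightarrow> fine_partition \<delta> \<pi> \<and> fine_partition \<delta>' \<pi>"
  by (auto simp: fine_partition_def max_ball_def)

text \<open>Used to delete and restore values on the boundary of an interval, where every gauge
  admits intervals reaching to both sides.\<close>

lemma has_mcshane_integral_null_change:
  fixes f g :: "real^'m \<Rightarrow> 'x::real_normed_vector"
  assumes f: "has_mcshane_integral f x W" and N: "{t \<in> W. f t \<noteq> g t} \<in> null_sets lebesgue"
  shows "has_mcshane_integral g x W"
  unfolding has_mcshane_integral_def
proof (intro allI impI)
  fix \<epsilon> :: real assume "\<epsilon> > 0"
  then have e2: "\<epsilon> / 2 > 0" by simp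
  obtain \<delta> where \<delta>: "gauge_on W \<delta>" "\<And>\<pi>. M_partition_of \<pi> W \<and> fine_partition \<delta> \<pi> \<Longrightarrow>
      norm (riemann_sum f \<pi> - x) < \<epsilon> / 2"
    using f e2 unfolding has_mcshane_integral_def by meson
  obtain \<delta>' where \<delta>': "gauge_on UNIV \<delta>'"
    "\<forall>\<pi>. M_partition_in \<pi> W \<and> fine_partition \<delta>' \<pi> \<longrightarrow> norm (riemann_sum f \<pi> - riemann_sum g \<pi>) < \<epsilon> / 2"
    using riemann_sum_null_change[OF N e2] by blast
  show "\<exists>\<delta>. gauge_on W \<delta> \<and> (\<forall>\<pi>. M_partition_of \<pi> W \<and> fine_partition \<delta> \<pi> \<longrightarrow>
           norm (riemann_sum g \<pi> - x) < \<epsilon>)"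
  proof (intro exI conjI allI impI)
    show "gauge_on W (\<lambda>t. min (\<delta> t) (\<delta>' t))"
      using \<delta>(1) gauge_on_subset[OF \<delta>'(1)] by (simp add: gauge_on_min)
    fix \<pi> assume "M_partition_of \<pi> W \<and> fine_partition (\<lambda>t. min (\<delta> t) (\<delta>' t)) \<pi>"
    then have "norm (riemann_sum f \<pi> - x) < \<epsilon> / 2"
      "norm (riemann_sum f \<pi> - riemann_sum g \<pi>) < \<epsilon> / 2"
      using \<delta>(2) \<delta>'(2) by (auto simp: fine_partition_min M_partition_of_def)
    moreover have "riemann_sum g \<pi> - x =
        (riemann_sum f \<pi> - x) - (riemann_sum f \<pi> - riemann_sum g \<pi>)" by simp
    ultimately show "norm (riemann_sum g \<pi> - x) < \<epsilon>"
      by (metis norm_diff_less_halves)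
  qed
qed

lemma henstock_primitive_null_change:
  fixes f g :: "real^'m \<Rightarrow> 'x::real_normed_vector"
  assumes f: "henstock_primitive f F W" and N: "{t \<in> W. f t \<noteq> g t} \<in> null_sets lebesgue"
  shows "henstock_primitive g F W"
  unfolding henstock_primitive_def
proof (intro allI impI)
  fix \<epsilon> :: real assume "\<epsilon> > 0"
  then have e2: "\<epsilon> / 2 > 0" by simp
  obtain \<delta> where \<delta>: "gauge_on W \<delta>" "\<And>\<pi>. M_partition_in \<pi> W \<and> fine_partition \<delta> \<pi> \<Longrightarrow>
      norm (\<Sum>(t, I)\<in>\<pi>. measure lebesgue I *\<^sub>R f t - F I) < \<epsilon> / 2"
    using f e2 unfolding henstock_primitive_def by meson
  obtain \<delta>' where \<delta>': "gauge_on UNIV \<delta>'"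
    "\<forall>\<pi>. M_partition_in \<pi> W \<and> fine_partition \<delta>' \<pi> \<longrightarrow> norm (riemann_sum f \<pi> - riemann_sum g \<pi>) < \<epsilon> / 2"
    using riemann_sum_null_change[OF N e2] by blast
  show "\<exists>\<delta>. gauge_on W \<delta> \<and> (\<forall>\<pi>. M_partition_in \<pi> W \<and> fine_partition \<delta> \<pi> \<longrightarrow>
           norm (\<Sum>(t, I)\<in>\<pi>. measure lebesgue I *\<^sub>R g t - F I) < \<epsilon>)"
  proof (intro exI conjI allI impI)
    show "gauge_on W (\<lambda>t. min (\<delta> t) (\<delta>' t))"
      using \<delta>(1) gauge_on_subset[OF \<delta>'(1)] by (simp add: gauge_on_min)
    fix \<pi> assume "M_partition_in \<pi> W \<and> fine_partition (\<lambda>t. min (\<delta> t) (\<delta>' t)) \<pi>"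
    then have *: "norm (\<Sum>(t, I)\<in>\<pi>. measure lebesgue I *\<^sub>R f t - F I) < \<epsilon> / 2"
      "norm (riemann_sum f \<pi> - riemann_sum g \<pi>) < \<epsilon> / 2"
      using \<delta>(2) \<delta>'(2) by (auto simp: fine_partition_min)
    have "(\<Sum>(t, I)\<in>\<pi>. measure lebesgue I *\<^sub>R g t - F I) =
        (\<Sum>(t, I)\<in>\<pi>. measure lebesgue I *\<^sub>R f t - F I) - (riemann_sum f \<pi> - riemann_sum g \<pi>)"
      by (simp add: case_prod_beta sum_subtractf)
    then show "norm (\<Sum>(t, I)\<in>\<pi>. measure lebesgue I *\<^sub>R g t - F I) < \<epsilon>"
      using norm_diff_less_halves[OF *] by simp
  qed
qed

text \<open>A partition in \<open>V\<close> is also a partition in \<open>W\<close>. A partition of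
  \<open>V\<close> is in general not one of \<open>W\<close>, which is why restriction to smaller
  sets goes through this property.\<close>

lemma henstock_primitive_subset:
  assumes "henstock_primitive f F W" "V \<subseteq> W"
  shows "henstock_primitive f F V"
  using assms M_partition_in_mono gauge_on_subset unfolding henstock_primitive_def by meson

lemma henstock_primitive_cong:
  assumes "henstock_primitive f F W" "\<And>t. t \<in> W \<Longrightarrow> f t = g t" "\<And>I. I \<in> intervals_in W \<Longrightarrow> F I = H I"
  shows "henstock_primitive g H W"
proof -
  have "(\<Sum>(t, I)\<in>\<pi>. measure lebesgue I *\<^sub>R f t - F I) = (\<Sum>(t, I)\<in>\<pi>. measure lebesgue I *\<^sub>R g t - H I)"
    if "M_partition_in \<pi> W" for \<pi>
    using that assms(2,3) by (intro sum.cong) (auto simp: M_partition_in_def)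
  then have eq: "(M_partition_in \<pi> W \<and> fine_partition \<delta> \<pi> \<longrightarrow>
         norm (\<Sum>(t, I)\<in>\<pi>. measure lebesgue I *\<^sub>R f t - F I) < \<epsilon>) \<longleftrightarrow>
       (M_partition_in \<pi> W \<and> fine_partition \<delta> \<pi> \<longrightarrow>
         norm (\<Sum>(t, I)\<in>\<pi>. measure lebesgue I *\<^sub>R g t - H I) < \<epsilon>)" for \<pi> \<delta> \<epsilon>
    by (cases "M_partition_in \<pi> W") simp_all
  show ?thesis using assms(1) unfolding henstock_primitive_def eq .
qed

text \<open>Cousin's lemma supplies a partition that is fine for both gauges, whose Riemann sum
  would be too close to both values.\<close>

lemma has_mcshane_integral_unique:
  assumes W: "W \<in> nondeg_intervals" 
    and f: "has_mcshane_integral f x W" "has_mcshane_integral f y W"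
  shows "x = y"
proof (rule ccontr)
  assume "x \<noteq> y"
  then have e: "norm (x - y) / 2 > 0" by simp
  obtain \<delta> where \<delta>: "gauge_on W \<delta>" "\<And>\<pi>. M_partition_of \<pi> W \<and> fine_partition \<delta> \<pi> \<Longrightarrow>
      norm (riemann_sum f \<pi> - x) < norm (x - y) / 2"
    using f(1) e unfolding has_mcshane_integral_def by meson
  obtain \<delta>' where \<delta>': "gauge_on W \<delta>'" "\<And>\<pi>. M_partition_of \<pi> W \<and> fine_partition \<delta>' \<pi> \<Longrightarrow>
      norm (riemann_sum f \<pi> - y) < norm (x - y) / 2"
    using f(2) e unfolding has_mcshane_integral_def by meson
  obtain \<pi> where \<pi>: "M_partition_of \<pi> W" "fine_partition (\<lambda>t. min (\<delta> t) (\<delta>' t)) \<pi>"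
    using cousin[OF W gauge_on_min[OF \<delta>(1) \<delta>'(1)]] by blast
  then have "norm (riemann_sum f \<pi> - x) < norm (x - y) / 2" "norm (riemann_sum f \<pi> - y) < norm (x - y) / 2"
    using \<delta>(2) \<delta>'(2) by (auto simp: fine_partition_min)
  then have "norm ((riemann_sum f \<pi> - y) - (riemann_sum f \<pi> - x)) < norm (x - y)"
    using norm_diff_less_halves by blast
  moreover have "(riemann_sum f \<pi> - y) - (riemann_sum f \<pi> - x) = x - y" by simp
  ultimately show False by simp
qed

lemma has_mcshane_integral_add:
  assumes f: "has_mcshane_integral f x W" and g: "has_mcshane_integral g y W"
  shows "has_mcshane_integral (\<lambda>t. f t + g t) (x + y) W"
  unfolding has_mcshane_integral_def
proof (intro allI impI)
  fix \<epsilon> :: real assume "\<epsilon> > 0"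
  then have e2: "\<epsilon> / 2 > 0" by simp
  obtain \<delta> where \<delta>: "gauge_on W \<delta>" "\<And>\<pi>. M_partition_of \<pi> W \<and> fine_partition \<delta> \<pi> \<Longrightarrow>
      norm (riemann_sum f \<pi> - x) < \<epsilon> / 2"
    using f e2 unfolding has_mcshane_integral_def by meson
  obtain \<delta>' where \<delta>': "gauge_on W \<delta>'" "\<And>\<pi>. M_partition_of \<pi> W \<and> fine_partition \<delta>' \<pi> \<Longrightarrow>
      norm (riemann_sum g \<pi> - y) < \<epsilon> / 2"
    using g e2 unfolding has_mcshane_integral_def by meson
  show "\<exists>\<delta>. gauge_on W \<delta> \<and> (\<forall>\<pi>. M_partition_of \<pi> W \<and> fine_partition \<delta> \<pi> \<longrightarrow>
           norm (riemann_sum (\<lambda>t. f t + g t) \<pi> - (x + y)) < \<epsilon>)"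
  proof (intro exI conjI allI impI)
    show "gauge_on W (\<lambda>t. min (\<delta> t) (\<delta>' t))" using \<delta>(1) \<delta>'(1) by (rule gauge_on_min)
    fix \<pi> assume "M_partition_of \<pi> W \<and> fine_partition (\<lambda>t. min (\<delta> t) (\<delta>' t)) \<pi>"
    then have *: "norm (riemann_sum f \<pi> - x) < \<epsilon> / 2" "norm (riemann_sum g \<pi> - y) < \<epsilon> / 2"
      using \<delta>(2) \<delta>'(2) by (auto simp: fine_partition_min)
    have "riemann_sum (\<lambda>t. f t + g t) \<pi> - (x + y) = (riemann_sum f \<pi> - x) + (riemann_sum g \<pi> - y)"
      by (simp add: case_prod_beta scaleR_add_right sum.distrib)
    then show "norm (riemann_sum (\<lambda>t. f t + g t) \<pi> - (x + y)) < \<epsilon>"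
      by (simp only: norm_add_less_halves[OF *])
  qed
qed

lemma M_partition_inD:
  assumes "M_partition_in \<pi> W"
  shows "finite \<pi>" "\<And>p. p \<in> \<pi> \<Longrightarrow> is_box (snd p)" "\<And>p. p \<in> \<pi> \<Longrightarrow> snd p \<subseteq> W"
    "\<And>p. p \<in> \<pi> \<Longrightarrow> fst p \<in> W" "\<And>p. p \<in> \<pi> \<Longrightarrow> snd p \<in> nondeg_intervals"
    "\<And>p q. p \<in> \<pi> \<Longrightarrow> q \<in> \<pi> \<Longrightarrow> p \<noteq> q \<Longrightarrow> nonoverlapping (snd p) (snd q)"
  using assms unfolding M_partition_in_def intervals_in_def by (fastforce intro: nondeg_is_box)+

text \<open>The set \<open>Q\<close> depends on \<pi> alone and the partitions \<open>P\<close> of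
  its members are chosen afterwards. Hence they can be made as fine as the cardinality of
  \<open>Q\<close> requires.\<close>

lemma finite_partition_complement:
  fixes W :: "(real^'m) set"
  assumes W: "W \<in> nondeg_intervals" and \<pi>: "M_partition_in \<pi> W"
  obtains Q where "finite Q" "Q \<subseteq> intervals_in W" 
    "\<forall>p\<in>\<pi>. \<forall>J\<in>Q. nonoverlapping (snd p) J"
    "\<forall>P. (\<forall>J\<in>Q. M_partition_of (P J) J) \<longrightarrow> M_partition_of (\<pi> \<union> (\<Union>J\<in>Q. P J)) W"
    "\<forall>P \<Phi>. (\<forall>J\<in>Q. M_partition_of (P J) J) \<longrightarrow>
       (sum \<Phi> (\<pi> \<union> (\<Union>J\<in>Q. P J)) :: 'x::real_normed_vector) = sum \<Phi> \<pi> + (\<Sum>J\<in>Q. sum \<Phi> (P J))"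
    "\<forall>F :: (real^'m) set \<Rightarrow> 'x. additive_interval_fun F W \<longrightarrow>
       F W = (\<Sum>(t,I)\<in>\<pi>. F I) + (\<Sum>J\<in>Q. F J)"
proof -
  note \<pi>D = M_partition_inD[OF \<pi>]
  obtain Q where Q: "finite Q" "Q \<subseteq> intervals_in W" "pairwise nonoverlapping Q"
    "\<forall>p\<in>\<pi>. \<forall>J\<in>Q. nonoverlapping (snd p) J"
    "snd ` {p \<in> \<pi>. snd p \<in> nondeg_intervals} \<union> Q division_of W"
    "snd ` {p \<in> \<pi>. snd p \<in> nondeg_intervals} \<inter> Q = {}"
    by (rule division_complement[OF W, of \<pi> snd, OF \<pi>D(1,2,6,3)])
  have eq\<pi>: "{p \<in> \<pi>. snd p \<in> nondeg_intervals} = \<pi>" using \<pi>D(5) by blast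
  note Q5 = Q(5)[unfolded eq\<pi>] and Q6 = Q(6)[unfolded eq\<pi>]
  have Qn: "J \<in> nondeg_intervals" "J \<subseteq> W" if "J \<in> Q" for J 
    using Q(2) that by (auto simp: intervals_in_def)
  have main: "M_partition_of (\<pi> \<union> (\<Union>J\<in>Q. P J)) W \<and>
      (\<forall>\<Phi> :: _ \<Rightarrow> 'x. sum \<Phi> (\<pi> \<union> (\<Union>J\<in>Q. P J)) = sum \<Phi> \<pi> + (\<Sum>J\<in>Q. sum \<Phi> (P J)))"
    if P: "\<forall>J\<in>Q. M_partition_of (P J) J" for P
  proof (intro conjI allI)
    have PJ: "M_partition_in (P J) J" "(\<Union>(t, I)\<in>P J. I) = J" if "J \<in> Q" for J
      using P that by (auto simp: M_partition_of_def)
    have PQ: "nonoverlapping (snd p) (snd q)" if "J \<in> Q" "J' \<in> Q" "J \<noteq> J'" "p \<in> P J" "q \<in> P J'" for p q J J'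
    proof -
      have "nonoverlapping J J'" using Q(3) that by (auto simp: pairwise_def)
      then show ?thesis
        using M_partition_inD(3)[OF PJ(1)] that by (meson nonoverlapping_subset)
    qed
    have P\<pi>: "nonoverlapping (snd p) (snd q)" if "J \<in> Q" "p \<in> \<pi>" "q \<in> P J" for p q J
    proof -
      have "nonoverlapping (snd p) J" using Q(4) that by auto
      then show ?thesis
        using M_partition_inD(3)[OF PJ(1)] that by (meson nonoverlapping_subset order_refl)
    qed
    have sym: "nonoverlapping A B \<Longrightarrow> nonoverlapping B A" for A B :: "(real^'m) set"
      by (auto simp: nonoverlapping_def)
    have "M_partition_in (\<pi> \<union> (\<Union>J\<in>Q. P J)) W"
      unfolding M_partition_in_def
    proof (intro conjI ballI impI)
      show "finite (\<pi> \<union> (\<Union>J\<in>Q. P J))" using \<pi>D(1) Q(1) M_partition_inD(1)[OF PJ(1)] by auto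
      fix p assume p: "p \<in> \<pi> \<union> (\<Union>J\<in>Q. P J)"
      show "case p of (t, I) \<Rightarrow> t \<in> W \<and> I \<in> intervals_in W"
      proof (cases "p \<in> \<pi>")
        case True
        then show ?thesis using \<pi>D(3-5)[of p] by (auto simp: intervals_in_def)
      next
        case False
        then obtain J where J: "J \<in> Q" "p \<in> P J" using p by blast
        then show ?thesis using M_partition_inD(3-5)[OF PJ(1)[OF J(1)] J(2)] Qn(2)[OF J(1)]
          by (auto simp: intervals_in_def)
      qed
      fix q assume q: "q \<in> \<pi> \<union> (\<Union>J\<in>Q. P J)" and ne: "p \<noteq> q"
      consider "p \<in> \<pi>" "q \<in> \<pi>" | J where "J \<in> Q" "p \<in> \<pi>" "q \<in> P J" | J where "J \<in> Q" "q \<in> \<pi>" "p \<in> P J"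
        | J J' where "J \<in> Q" "J' \<in> Q" "p \<in> P J" "q \<in> P J'" using p q by blast
      then show "nonoverlapping (snd p) (snd q)"
      proof cases
        case 1
        then show ?thesis using \<pi>D(6) ne by blast
      next
        case 2
        then show ?thesis by (rule P\<pi>)
      next
        case 3
        then show ?thesis by (rule sym[OF P\<pi>])
      next
        case (4 J J')
        then show ?thesis
          using PQ[OF 4(1,2) _ 4(3,4)] M_partition_inD(6)[OF PJ(1)[OF 4(1)] 4(3) _ ne] by blast
      qed
    qed
    moreover have "(\<Union>(t, I)\<in>\<pi> \<union> (\<Union>J\<in>Q. P J). I) = W"
    proof -
      have "(\<Union>(t, I)\<in>\<pi> \<union> (\<Union>J\<in>Q. P J). I) = \<Union>(snd ` \<pi>) \<union> (\<Union>J\<in>Q. \<Union>(t, I)\<in>P J. I)" by auto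
      also have "\<dots> = \<Union>(snd ` \<pi> \<union> Q)" using PJ(2) by simp
      also have "\<dots> = W" using division_ofD(6)[OF Q5] .
      finally show ?thesis .
    qed
    ultimately show "M_partition_of (\<pi> \<union> (\<Union>J\<in>Q. P J)) W" by (simp add: M_partition_of_def)
    fix \<Phi> :: "(real^'m) \<times> (real^'m) set \<Rightarrow> 'x"
    \<comment> \<open>A pair belonging to two of the partitions would make a non-degenerate interval
      not overlap itself, so the sets of pairs are disjoint.\<close>
    have disj: "p \<noteq> q" if "nonoverlapping (snd p) (snd q)" "snd p \<in> nondeg_intervals"
      for p q :: "(real^'m) \<times> (real^'m) set"
      using that nondeg_self_overlap by auto
    have d1: "\<pi> \<inter> (\<Union>J\<in>Q. P J) = {}" using P\<pi> disj \<pi>D(5) by blast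
    have d2: "P J \<inter> P J' = {}" if "J \<in> Q" "J' \<in> Q" "J \<noteq> J'" for J J'
      using PQ[OF that] disj M_partition_inD(5)[OF PJ(1)[OF that(1)]] by blast
    have f: "finite (P J)" if "J \<in> Q" for J using M_partition_inD(1)[OF PJ(1)[OF that]] .
    have "sum \<Phi> (\<Union>J\<in>Q. P J) = (\<Sum>J\<in>Q. sum \<Phi> (P J))"
      using d2 f Q(1) by (intro sum.UNION_disjoint) auto
    then show "sum \<Phi> (\<pi> \<union> (\<Union>J\<in>Q. P J)) = sum \<Phi> \<pi> + (\<Sum>J\<in>Q. sum \<Phi> (P J))"
      using d1 f Q(1) \<pi>D(1) by (subst sum.union_disjoint) auto
  qed
  have add: "F W = (\<Sum>(t,I)\<in>\<pi>. F I) + (\<Sum>J\<in>Q. F J)"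
    if F: "additive_interval_fun F W" for F :: "(real^'m) set \<Rightarrow> 'x"
  proof -
    have "nondeg_ext F W = (\<Sum>p\<in>\<pi>. nondeg_ext F (snd p)) + (\<Sum>J\<in>Q. F J)"
      using additive_complement[OF F order_refl nondeg_is_box[OF W] \<pi>D(1,6) Q(5,6)] Qn by blast
    also have "(\<Sum>p\<in>\<pi>. nondeg_ext F (snd p)) = (\<Sum>(t,I)\<in>\<pi>. F I)"
      using \<pi>D(5) by (intro sum.cong) (auto simp: nondeg_ext_def)
    finally show ?thesis using W by (simp add: nondeg_ext_def)
  qed
  show thesis
    by (rule that[OF Q(1,2,4)]) (use main add in blast)+
qed

section \<open>From integrals to the Saks-Henstock property and back\<close>

lemma interval_boundary_null:
  fixes K :: "(real^'m) set"
  assumes "is_box K" "S \<subseteq> K - interior K"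
  shows "S \<in> null_sets lebesgue"
proof -
  obtain a b where "K = cbox a b" using assms(1) by (rule is_boxE)
  then have "negligible S"
    using negligible_frontier_interval[of a b] assms(2) negligible_subset by (metis interior_cbox)
  then show ?thesis by (simp add: negligible_iff_null_sets)
qed

lemma nonoverlapping_sym: "nonoverlapping I J \<Longrightarrow> nonoverlapping J I"
  by (auto simp: nonoverlapping_def)

text \<open>A non-degenerate interval is the closure of its interior, and an open set that misses a
  set misses its closure. So a tag anywhere in \<open>J\<close>, even on its boundary, stays out of
  the interior of \<open>K\<close>.\<close>

lemma nonoverlapping_Int_interior:
  assumes "J \<in> nondeg_intervals" "nonoverlapping J K"
  shows "J \<inter> interior K = {}"
proof -
  obtain a b where J: "J = cbox a b" using nondeg_is_box[OF assms(1)] by (rule is_boxE)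
  have "box a b \<noteq> {}" using assms(1) by (simp add: J nondeg_intervals_iff)
  then have "J = closure (interior J)" by (simp add: J closure_box)
  moreover have "interior K \<inter> closure (interior J) = {}"
    using assms(2) open_Int_closure_eq_empty[OF open_interior] by (auto simp: nonoverlapping_def)
  ultimately show ?thesis by blast
qed

lemma negligible_Int_imp_nonoverlapping:
  assumes "negligible (I \<inter> J)"
  shows "nonoverlapping I (J::(real^'m) set)"
proof -
  have "negligible (interior I \<inter> interior J)"
    using assms by (rule negligible_subset) (use interior_subset in blast)
  then show ?thesis unfolding nonoverlapping_def
    by (metis open_Int open_interior open_not_negligible)
qed

text \<open>The interior of a union can exceed the union of the interiors, so the argument passes
  through negligible intersections instead.\<close>

lemma nonoverlapping_Union:
  assumes "finite A" "\<And>a. a \<in> A \<Longrightarrow> is_box (K a)" "is_box J" "\<And>a. a \<in> A \<Longrightarrow> nonoverlapping (K a) J"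
  shows "nonoverlapping (\<Union>a\<in>A. K a) J"
proof -
  have "negligible (\<Union>a\<in>A. K a \<inter> J)"
    using assms by (intro negligible_Union) (auto intro!: negligible_Int_nonoverlapping)
  then have "negligible ((\<Union>a\<in>A. K a) \<inter> J)" by (simp add: Int_UN_distrib2 Int_commute)
  then show ?thesis by (rule negligible_Int_imp_nonoverlapping)
qed

text \<open>Primitives are defined by cut-off functions on the large interval; this turns their
  values into integrals over \<open>K\<close> itself. A fine partition of \<open>K\<close> is
  completed by Cousin's lemma to one of \<open>W\<close>, without changing its Riemann sum.\<close>

lemma has_mcshane_integral_subinterval:
  fixes f :: "real^'m \<Rightarrow> 'x::real_normed_vector"
  assumes W: "W \<in> nondeg_intervals" and K: "K \<in> intervals_in W"
    and f: "has_mcshane_integral (\<lambda>t. indicat_real K t *\<^sub>R f t) x W"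
  shows "has_mcshane_integral f x K"
proof -
  \<comment> \<open>\<open>g\<close> vanishes on the boundary of \<open>K\<close>, hence at all tags of a partition of the rest of \<open>W\<close>.\<close>
  define g where "g t = indicat_real (interior K) t *\<^sub>R f t" for t
  have Kb: "is_box K" and KW: "K \<subseteq> W" using K nondeg_is_box by (auto simp: intervals_in_def)
  have "{t \<in> W. indicat_real K t *\<^sub>R f t \<noteq> g t} \<in> null_sets lebesgue"
    by (rule interval_boundary_null[OF Kb])
      (use interior_subset[of K] in \<open>auto simp: g_def indicator_def\<close>)
  then have g: "has_mcshane_integral g x W"
    using has_mcshane_integral_null_change[OF f] by blast
  have "has_mcshane_integral g x K"
    unfolding has_mcshane_integral_def
  proof (intro allI impI)
    fix \<epsilon> :: real assume "\<epsilon> > 0"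
    then obtain \<delta> where \<delta>: "gauge_on W \<delta>" "\<And>\<pi>. M_partition_of \<pi> W \<and> fine_partition \<delta> \<pi> \<Longrightarrow>
        norm (riemann_sum g \<pi> - x) < \<epsilon>"
      using g unfolding has_mcshane_integral_def by meson
    have "norm (riemann_sum g \<pi> - x) < \<epsilon>" if \<pi>: "M_partition_of \<pi> K" "fine_partition \<delta> \<pi>" for \<pi>
    proof -
      have \<pi>K: "M_partition_in \<pi> K" "(\<Union>(t,I)\<in>\<pi>. I) = K" using \<pi> by (auto simp: M_partition_of_def)
      note \<pi>W = M_partition_in_mono[OF \<pi>K(1) KW]
      obtain Q where Q: "finite Q" "Q \<subseteq> intervals_in W" "\<forall>p\<in>\<pi>. \<forall>J\<in>Q. nonoverlapping (snd p) J"
        "\<forall>P. (\<forall>J\<in>Q. M_partition_of (P J) J) \<longrightarrow> M_partition_of (\<pi> \<union> (\<Union>J\<in>Q. P J)) W"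
        "\<forall>P \<Phi>. (\<forall>J\<in>Q. M_partition_of (P J) J) \<longrightarrow>
           (sum \<Phi> (\<pi> \<union> (\<Union>J\<in>Q. P J)) :: 'x) = sum \<Phi> \<pi> + (\<Sum>J\<in>Q. sum \<Phi> (P J))"
        "\<forall>F :: (real^'m) set \<Rightarrow> 'x. additive_interval_fun F W \<longrightarrow>
           F W = (\<Sum>(t,I)\<in>\<pi>. F I) + (\<Sum>J\<in>Q. F J)"
        by (rule finite_partition_complement[OF W \<pi>W])
      have "\<exists>p. M_partition_of p J \<and> fine_partition \<delta> p" if "J \<in> Q" for J
      proof (rule cousin)
        show "J \<in> nondeg_intervals" "gauge_on J \<delta>"
          using that Q(2) gauge_on_subset[OF \<delta>(1)] by (auto simp: intervals_in_def)
      qed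
      then obtain P where P: "\<And>J. J \<in> Q \<Longrightarrow> M_partition_of (P J) J" "\<And>J. J \<in> Q \<Longrightarrow> fine_partition \<delta> (P J)"
        by metis
      define \<pi>' where "\<pi>' = \<pi> \<union> (\<Union>J\<in>Q. P J)"
      have "M_partition_of \<pi>' W" using Q(4) P unfolding \<pi>'_def by blast
      moreover have "fine_partition \<delta> \<pi>'"
        using \<pi>(2) P(2) unfolding \<pi>'_def fine_partition_def by blast
      ultimately have "norm (riemann_sum g \<pi>' - x) < \<epsilon>" using \<delta>(2) by blast
      moreover have "riemann_sum g \<pi>' = riemann_sum g \<pi> + (\<Sum>J\<in>Q. riemann_sum g (P J))"
        using Q(5) P(1) unfolding \<pi>'_def by blast
      moreover have "riemann_sum g (P J) = 0" if J: "J \<in> Q" for J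
      proof (rule sum.neutral, clarify)
        fix t I assume tI: "(t, I) \<in> P J"
        have Jn: "J \<in> nondeg_intervals" using J Q(2) by (auto simp: intervals_in_def)
        have "t \<in> J" using P(1)[OF J] tI by (auto simp: M_partition_of_def M_partition_in_def)
        moreover have "nonoverlapping (\<Union>p\<in>\<pi>. snd p) J"
          using M_partition_inD[OF \<pi>K(1)] Q(3) J nondeg_is_box[OF Jn]
          by (intro nonoverlapping_Union) auto
        then have "nonoverlapping J K" using \<pi>K(2) nonoverlapping_sym by (auto simp: case_prod_beta)
        then have "J \<inter> interior K = {}" using nonoverlapping_Int_interior[OF Jn] by blast
        ultimately show "measure lebesgue I *\<^sub>R g t = 0" by (auto simp: g_def indicator_def)
      qed
      ultimately show ?thesis by simp
    qed
    then show "\<exists>\<delta>. gauge_on K \<delta> \<and> (\<forall>\<pi>. M_partition_of \<pi> K \<and> fine_partition \<delta> \<pi> \<longrightarrow>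
        norm (riemann_sum g \<pi> - x) < \<epsilon>)"
      using gauge_on_subset[OF \<delta>(1) KW] by blast
  qed
  moreover have "{t \<in> K. g t \<noteq> f t} \<in> null_sets lebesgue"
    by (rule interval_boundary_null[OF Kb]) (auto simp: g_def indicator_def)
  ultimately show ?thesis by (rule has_mcshane_integral_null_change)
qed

text \<open>The indicators of \<open>I\<close> and \<open>J\<close> add up to that of the union
  except on the negligible set \<open>I \<inter> J\<close>; uniqueness of the integral does the
  rest.\<close>

lemma mcshane_primitive_additive:
  fixes f :: "real^'m \<Rightarrow> 'x::real_normed_vector"
  assumes W: "W \<in> nondeg_intervals" and f: "mcshane_integrable_with_primitive f W F"
  shows "additive_interval_fun F W"
  unfolding additive_interval_fun_def
proof (intro ballI impI)
  fix I J assume IJ: "I \<in> intervals_in W" "J \<in> intervals_in W" 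
    and un: "nonoverlapping I J \<and> I \<union> J \<in> intervals_in W"
  note F = f[unfolded mcshane_integrable_with_primitive_def, THEN conjunct2, rule_format]
  have "has_mcshane_integral (\<lambda>t. indicat_real I t *\<^sub>R f t + indicat_real J t *\<^sub>R f t) (F I + F J) W"
    using F[OF IJ(1)] F[OF IJ(2)] by (rule has_mcshane_integral_add)
  moreover have "{t \<in> W. indicat_real I t *\<^sub>R f t + indicat_real J t *\<^sub>R f t 
      \<noteq> indicat_real (I \<union> J) t *\<^sub>R f t} \<in> null_sets lebesgue"
  proof -
    have "negligible (I \<inter> J)"
      using IJ un nondeg_is_box by (intro negligible_Int_nonoverlapping) (auto simp: intervals_in_def)
    then have "negligible {t \<in> W. indicat_real I t *\<^sub>R f t + indicat_real J t *\<^sub>R f t 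
      \<noteq> indicat_real (I \<union> J) t *\<^sub>R f t}"
      by (rule negligible_subset) (auto simp: indicator_def split: if_splits)
    then show ?thesis by (simp add: negligible_iff_null_sets)
  qed
  ultimately have "has_mcshane_integral (\<lambda>t. indicat_real (I \<union> J) t *\<^sub>R f t) (F I + F J) W"
    by (rule has_mcshane_integral_null_change)
  then show "F (I \<union> J) = F I + F J"
    using has_mcshane_integral_unique[OF W F] un by blast
qed

text \<open>The Saks-Henstock argument: complete \<pi> by partitions of the complementary intervals
  whose Riemann sums nearly equal the values of \<open>F\<close> there. The gauge on
  \<open>W\<close> bounds the total error, and subtracting the small error on \<open>Q\<close>
  leaves the error of \<pi>.\<close>

lemma mcshane_primitive_henstock:
  fixes f :: "real^'m \<Rightarrow> 'x::real_normed_vector"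
  assumes W: "W \<in> nondeg_intervals" and f: "mcshane_integrable_with_primitive f W F"
  shows "henstock_primitive f F W"
  unfolding henstock_primitive_def
proof (intro allI impI)
  fix \<epsilon> :: real assume \<epsilon>: "\<epsilon> > 0"
  note add = mcshane_primitive_additive[OF W f]
  note F = f[unfolded mcshane_integrable_with_primitive_def, THEN conjunct2, rule_format]
  have FJ: "has_mcshane_integral f (F J) J" if "J \<in> intervals_in W" for J
    using has_mcshane_integral_subinterval[OF W that F[OF that]] .
  have WW: "W \<in> intervals_in W" using W by (simp add: intervals_in_def)
  obtain \<delta> where \<delta>: "gauge_on W \<delta>" "\<And>\<pi>. M_partition_of \<pi> W \<and> fine_partition \<delta> \<pi> \<Longrightarrow>
      norm (riemann_sum f \<pi> - F W) < \<epsilon> / 2"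
    using FJ[OF WW] \<epsilon> unfolding has_mcshane_integral_def by (meson half_gt_zero)
  have "norm (\<Sum>(t, I)\<in>\<pi>. measure lebesgue I *\<^sub>R f t - F I) < \<epsilon>"
    if \<pi>: "M_partition_in \<pi> W" "fine_partition \<delta> \<pi>" for \<pi>
  proof -
    obtain Q where Q: "finite Q" "Q \<subseteq> intervals_in W" "\<forall>p\<in>\<pi>. \<forall>J\<in>Q. nonoverlapping (snd p) J"
      "\<forall>P. (\<forall>J\<in>Q. M_partition_of (P J) J) \<longrightarrow> M_partition_of (\<pi> \<union> (\<Union>J\<in>Q. P J)) W"
      "\<forall>P \<Phi>. (\<forall>J\<in>Q. M_partition_of (P J) J) \<longrightarrow>
         (sum \<Phi> (\<pi> \<union> (\<Union>J\<in>Q. P J)) :: 'x) = sum \<Phi> \<pi> + (\<Sum>J\<in>Q. sum \<Phi> (P J))"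
      "\<forall>F :: (real^'m) set \<Rightarrow> 'x. additive_interval_fun F W \<longrightarrow>
         F W = (\<Sum>(t,I)\<in>\<pi>. F I) + (\<Sum>J\<in>Q. F J)"
      by (rule finite_partition_complement[OF W \<pi>(1)])
    \<comment> \<open>The error \<open>\<epsilon> / 2\<close> is shared among the members of
      \<open>Q\<close>; adding 1 covers the case that \<open>Q\<close> is empty.\<close>
    define \<eta> where "\<eta> = \<epsilon> / (2 * (real (card Q) + 1))"
    have \<eta>: "\<eta> > 0" using \<epsilon> by (simp add: \<eta>_def)
    have "\<exists>p. M_partition_of p J \<and> fine_partition \<delta> p \<and> norm (riemann_sum f p - F J) < \<eta>" if "J \<in> Q" for J
    proof -
      have J: "J \<in> intervals_in W" "J \<in> nondeg_intervals" "J \<subseteq> W"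
        using that Q(2) by (auto simp: intervals_in_def)
      obtain \<delta>' where \<delta>': "gauge_on J \<delta>'" "\<And>\<pi>. M_partition_of \<pi> J \<and> fine_partition \<delta>' \<pi> \<Longrightarrow>
          norm (riemann_sum f \<pi> - F J) < \<eta>"
        using FJ[OF J(1)] \<eta> unfolding has_mcshane_integral_def by meson
      obtain p where "M_partition_of p J" "fine_partition (\<lambda>t. min (\<delta> t) (\<delta>' t)) p"
        using cousin[OF J(2) gauge_on_min[OF gauge_on_subset[OF \<delta>(1) J(3)] \<delta>'(1)]] by blast
      then show ?thesis using \<delta>'(2)[of p] by (auto simp: fine_partition_min)
    qed
    then obtain P where P: "\<And>J. J \<in> Q \<Longrightarrow> M_partition_of (P J) J" "\<And>J. J \<in> Q \<Longrightarrow> fine_partition \<delta> (P J)"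
      "\<And>J. J \<in> Q \<Longrightarrow> norm (riemann_sum f (P J) - F J) < \<eta>"
      by metis
    define \<pi>' where "\<pi>' = \<pi> \<union> (\<Union>J\<in>Q. P J)"
    have "M_partition_of \<pi>' W" using Q(4) P unfolding \<pi>'_def by blast
    moreover have "fine_partition \<delta> \<pi>'"
      using \<pi>(2) P(2) unfolding \<pi>'_def fine_partition_def by blast
    ultimately have 1: "norm (riemann_sum f \<pi>' - F W) < \<epsilon> / 2" using \<delta>(2) by blast
    have 2: "norm (\<Sum>J\<in>Q. riemann_sum f (P J) - F J) \<le> \<epsilon> / 2"
    proof -
      have "norm (\<Sum>J\<in>Q. riemann_sum f (P J) - F J) \<le> (\<Sum>J\<in>Q. \<eta>)"
        using P(3) by (intro order_trans[OF norm_sum] sum_mono) (auto intro: less_imp_le)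
      also have "\<dots> = real (card Q) * \<eta>" by simp
      also have "\<dots> \<le> (real (card Q) + 1) * \<eta>" using \<eta> by simp
      also have "\<dots> = \<epsilon> / 2"
      proof -
        have cancel: "c * (\<epsilon> / (2 * c)) = \<epsilon> / 2" if "c > 0" for c :: real using that by simp
        show ?thesis unfolding \<eta>_def by (rule cancel) simp
      qed
      finally show ?thesis .
    qed
    have "riemann_sum f \<pi>' = riemann_sum f \<pi> + (\<Sum>J\<in>Q. riemann_sum f (P J))"
      using Q(5) P(1) unfolding \<pi>'_def by blast
    moreover have "F W = (\<Sum>(t,I)\<in>\<pi>. F I) + (\<Sum>J\<in>Q. F J)" using Q(6) add by blast
    ultimately have eq: "(\<Sum>(t, I)\<in>\<pi>. measure lebesgue I *\<^sub>R f t - F I) =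
        (riemann_sum f \<pi>' - F W) - (\<Sum>J\<in>Q. riemann_sum f (P J) - F J)"
      by (simp add: case_prod_beta sum_subtractf)
    show ?thesis unfolding eq using 1 2 
      norm_triangle_ineq4[of "riemann_sum f \<pi>' - F W" "\<Sum>J\<in>Q. riemann_sum f (P J) - F J"]
      by linarith
  qed
  then show "\<exists>\<delta>. gauge_on W \<delta> \<and> (\<forall>\<pi>. M_partition_in \<pi> W \<and> fine_partition \<delta> \<pi> \<longrightarrow>
      norm (\<Sum>(t, I)\<in>\<pi>. measure lebesgue I *\<^sub>R f t - F I) < \<epsilon>)"
    using \<delta>(1) by blast
qed

text \<open>To integrate over \<open>I\<close>, each interval of a partition of \<open>W\<close> is
  intersected with \<open>I\<close> and keeps its tag. The resulting sum agrees with the Riemann sum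
  of the cut-off function if no interval crosses the boundary of \<open>I\<close>. The gauge ensures
  this for tags off the boundary, and \<open>g\<close> vanishes at tags on it.\<close>

lemma henstock_imp_mcshane_primitive:
  fixes f :: "real^'m \<Rightarrow> 'x::real_normed_vector"
  assumes W: "W \<in> nondeg_intervals" and F: "additive_interval_fun F W" 
    and f: "henstock_primitive f F W"
  shows "mcshane_integrable_with_primitive f W F"
  unfolding mcshane_integrable_with_primitive_def
proof (intro conjI ballI)
  have primitive: "has_mcshane_integral (\<lambda>t. indicat_real I t *\<^sub>R f t) (F I) W" 
    if I: "I \<in> intervals_in W" for I
  proof -
    have Ib: "is_box I" "I \<subseteq> W" "I \<in> nondeg_intervals" using I nondeg_is_box by (auto simp: intervals_in_def)
    define g where "g t = (if t \<in> I - interior I then 0 else f t)" for t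
    have "{t \<in> W. f t \<noteq> g t} \<in> null_sets lebesgue"
      by (rule interval_boundary_null[OF Ib(1)]) (auto simp: g_def split: if_splits)
    then have g: "henstock_primitive g F W" using henstock_primitive_null_change[OF f] by blast
    have "has_mcshane_integral (\<lambda>t. indicat_real I t *\<^sub>R g t) (F I) W"
      unfolding has_mcshane_integral_def
    proof (intro allI impI)
      fix \<epsilon> :: real assume \<epsilon>: "\<epsilon> > 0"
      obtain \<delta> where \<delta>: "gauge_on W \<delta>" "\<forall>\<pi>. M_partition_in \<pi> W \<and> fine_partition \<delta> \<pi> \<longrightarrow>
          norm (\<Sum>(t, I)\<in>\<pi>. measure lebesgue I *\<^sub>R g t - F I) < \<epsilon>"
        using g \<epsilon> unfolding henstock_primitive_def by meson
      \<comment> \<open>Both kinds of crossing are excluded: an interval tagged in the interior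
        cannot leave \<open>I\<close>, and one tagged outside cannot enter it.\<close>
      have "\<exists>r>0. (t \<in> interior I \<longrightarrow> max_ball t r \<subseteq> interior I) \<and> (t \<notin> I \<longrightarrow> max_ball t r \<subseteq> - I)" for t
      proof -
        have "closed I" using Ib(1) by (auto elim: is_boxE)
        then show ?thesis
          using max_ball_in_open[of "interior I" t] max_ball_in_open[of "- I" t] interior_subset[of I]
          by (metis ComplI open_Compl open_interior subsetD zero_less_one)
      qed
      then obtain \<rho> where \<rho>: "\<And>t. \<rho> t > 0" "\<And>t. t \<in> interior I \<Longrightarrow> max_ball t (\<rho> t) \<subseteq> interior I"
        "\<And>t. t \<notin> I \<Longrightarrow> max_ball t (\<rho> t) \<subseteq> - I" by metis
      show "\<exists>\<delta>. gauge_on W \<delta> \<and> (\<forall>\<pi>. M_partition_of \<pi> W \<and> fine_partition \<delta> \<pi> \<longrightarrow>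
          norm (riemann_sum (\<lambda>t. indicat_real I t *\<^sub>R g t) \<pi> - F I) < \<epsilon>)"
      proof (intro exI conjI allI impI)
        show "gauge_on W (\<lambda>t. min (\<delta> t) (\<rho> t))" using \<delta>(1) \<rho>(1) by (simp add: gauge_on_def)
        fix \<pi> assume "M_partition_of \<pi> W \<and> fine_partition (\<lambda>t. min (\<delta> t) (\<rho> t)) \<pi>"
        then have \<pi>: "M_partition_in \<pi> W" "(\<Union>(t, J)\<in>\<pi>. J) = W" "fine_partition \<delta> \<pi>" "fine_partition \<rho> \<pi>" 
          by (auto simp: M_partition_of_def fine_partition_min)
        note \<pi>D = M_partition_inD[OF \<pi>(1)]
        have no: "nonoverlapping (snd p \<inter> I) (snd q \<inter> I)" if "p \<in> \<pi>" "q \<in> \<pi>" "p \<noteq> q" for p q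
          by (rule nonoverlapping_subset[OF \<pi>D(6)[OF that]]) auto
        have box: "is_box (snd p \<inter> I)" if "p \<in> \<pi>" for p using \<pi>D(2)[OF that] Ib(1) by (rule is_box_Int)
        have fineD: "snd p \<subseteq> max_ball (fst p) (\<delta> (fst p))" "snd p \<subseteq> max_ball (fst p) (\<rho> (fst p))" 
          if "p \<in> \<pi>" for p
          by (rule fine_partitionD[OF \<pi>(3) that], rule fine_partitionD[OF \<pi>(4) that])
        have "norm (\<Sum>p\<in>\<pi>. measure lebesgue (snd p \<inter> I) *\<^sub>R g (fst p) - nondeg_ext F (snd p \<inter> I)) < \<epsilon>"
        proof (rule henstock_primitive_family[OF \<delta>(2) \<pi>D(1) no box \<pi>D(4)])
          fix p assume "p \<in> \<pi>"
          then show "snd p \<inter> I \<subseteq> W" "snd p \<inter> I \<subseteq> max_ball (fst p) (\<delta> (fst p))"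
            using fineD(1)[of p] Ib(2) by auto
        qed
        moreover have "(\<Sum>p\<in>\<pi>. nondeg_ext F (snd p \<inter> I)) = F I"
        proof (rule additive_family[OF F Ib(2,3) \<pi>D(1) box no])
          have "(\<Union>p\<in>\<pi>. snd p \<inter> I) = (\<Union>(t, J)\<in>\<pi>. J) \<inter> I" by auto
          then show "(\<Union>p\<in>\<pi>. snd p \<inter> I) = I" unfolding \<pi>(2) using Ib(2) by blast
        qed
        moreover have "measure lebesgue (snd p \<inter> I) *\<^sub>R g (fst p) = 
            measure lebesgue (snd p) *\<^sub>R indicat_real I (fst p) *\<^sub>R g (fst p)" if p: "p \<in> \<pi>" for p
        proof -
          consider "fst p \<in> interior I" | "fst p \<in> I - interior I" | "fst p \<notin> I" by blast
          then show ?thesis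
          proof cases
            case 1
            then have "snd p \<subseteq> I" using fineD(2)[OF p] \<rho>(2) interior_subset[of I] by blast
            then show ?thesis using 1 interior_subset[of I] by (auto simp: Int_absorb2)
          next
            case 2
            then show ?thesis by (simp add: g_def)
          next
            case 3
            then have "snd p \<inter> I = {}" using fineD(2)[OF p] \<rho>(3) by blast
            then show ?thesis using 3 by simp
          qed
        qed
        ultimately show "norm (riemann_sum (\<lambda>t. indicat_real I t *\<^sub>R g t) \<pi> - F I) < \<epsilon>"
          by (simp add: case_prod_beta sum_subtractf)
      qed
    qed
    moreover have "{t \<in> W. indicat_real I t *\<^sub>R g t \<noteq> indicat_real I t *\<^sub>R f t} \<in> null_sets lebesgue"
      by (rule interval_boundary_null[OF Ib(1)]) (auto simp: g_def indicator_def split: if_splits)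
    ultimately show ?thesis by (rule has_mcshane_integral_null_change)
  qed
  then show "\<And>I. I \<in> intervals_in W \<Longrightarrow> has_mcshane_integral (\<lambda>t. indicat_real I t *\<^sub>R f t) (F I) W" .
  \<comment> \<open>The case \<open>I = W\<close>, where the cut-off has no effect on
    \<open>W\<close>.\<close>
  have "has_mcshane_integral f (F W) W"
    using W by (intro has_mcshane_integral_subinterval[OF W _ primitive]) (auto simp: intervals_in_def)
  then show "mcshane_integrable_on f W" by (auto simp: mcshane_integrable_on_def)
qed

subsection \<open>Series over divisions\<close>

text \<open>Absolute continuity of \<open>F\<close> that ignores the part of the family outside
  \<open>U\<close>. Each \<open>K \<inter> I\<close> keeps the tag of \<open>I\<close>, so the
  intersections are still fine, and by the Saks-Henstock property the sum of \<open>F\<close> over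
  the family is close to a Riemann sum. That sum involves only the finitely many values of
  \<open>f\<close> at tags of the fixed \<pi>, so \<open>f\<close> may be unbounded.\<close>

lemma henstock_relative_continuity:
  fixes f :: "real^'m \<Rightarrow> 'x::real_normed_vector"
  assumes W: "W \<in> nondeg_intervals" and F: "additive_interval_fun F W"
    and f: "henstock_primitive f F W"
    and U: "open U" "\<And>t. t \<in> W - U \<Longrightarrow> f t = 0" and \<epsilon>: "\<epsilon> > 0"
  shows "\<exists>\<eta>>0. \<forall>\<K>. finite \<K> \<and> \<K> \<subseteq> intervals_in W \<and> pairwise nonoverlapping \<K> \<and>
      measure lebesgue (\<Union>\<K> \<inter> U) < \<eta> \<longrightarrow> norm (\<Sum>K\<in>\<K>. F K) < \<epsilon>"
proof -
  obtain \<delta> where \<delta>: "gauge_on W \<delta>" "\<forall>\<pi>. M_partition_in \<pi> W \<and> fine_partition \<delta> \<pi> \<longrightarrow>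
      norm (\<Sum>(t, I)\<in>\<pi>. measure lebesgue I *\<^sub>R f t - F I) < \<epsilon> / 2"
    using f \<epsilon> unfolding henstock_primitive_def by (meson half_gt_zero)
  \<comment> \<open>Intervals tagged in \<open>U\<close> then lie in \<open>U\<close>, so their
    intersections with the family count towards the measure of
    \<open>\<Union>\<K> \<inter> U\<close>; tags outside \<open>U\<close> have weight 0.\<close>
  have "\<exists>r>0. t \<in> U \<longrightarrow> max_ball t r \<subseteq> U" for t
    using max_ball_in_open[OF U(1), of t] zero_less_one by blast
  then obtain \<rho> where \<rho>: "\<And>t. \<rho> t > 0" "\<And>t. t \<in> U \<Longrightarrow> max_ball t (\<rho> t) \<subseteq> U" by metis
  have "gauge_on W (\<lambda>t. min (\<delta> t) (\<rho> t))" using \<delta>(1) \<rho>(1) by (simp add: gauge_on_def)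
  then obtain \<pi> where \<pi>: "M_partition_of \<pi> W" "fine_partition \<delta> \<pi>" "fine_partition \<rho> \<pi>"
    using cousin[OF W] fine_partition_min by blast
  have \<pi>in: "M_partition_in \<pi> W" and \<pi>W: "(\<Union>(t,I)\<in>\<pi>. I) = W"
    using \<pi> by (auto simp: M_partition_of_def)
  note \<pi>D = M_partition_inD[OF \<pi>in]
  define M where "M = (\<Sum>p\<in>\<pi>. norm (f (fst p)))"
  have M: "M \<ge> 0" by (simp add: M_def sum_nonneg)
  \<comment> \<open>Chosen so that \<open>\<eta> * M\<close> stays below
    \<open>\<epsilon> / 2\<close>; the added 1 keeps the denominator positive when \<open>M\<close>
    is 0.\<close>
  define \<eta> where "\<eta> = \<epsilon> / (2 * (M + 1))"
  have \<eta>: "\<eta> > 0" "\<eta> * M < \<epsilon> / 2" using \<epsilon> M by (auto simp: \<eta>_def field_simps)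
  have "norm (\<Sum>K\<in>\<K>. F K) < \<epsilon>"
    if \<K>: "finite \<K>" "\<K> \<subseteq> intervals_in W" "pairwise nonoverlapping \<K>"
      and small: "measure lebesgue (\<Union>\<K> \<inter> U) < \<eta>" for \<K>
  proof -
    have K: "is_box k" "k \<subseteq> W" "k \<in> nondeg_intervals" if "k \<in> \<K>" for k 
      using \<K>(2) that by (auto simp: intervals_in_def nondeg_is_box)
    define A where "A = \<K> \<times> \<pi>"
    define B where "B a = fst a \<inter> snd (snd a)" for a :: "(real^'m) set \<times> ((real^'m) \<times> (real^'m) set)"
    have A: "finite A" using \<K>(1) \<pi>D(1) by (simp add: A_def)
    have no: "nonoverlapping (B a) (B b)" if "a \<in> A" "b \<in> A" "a \<noteq> b" for a b
    proof (cases "fst a = fst b")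
      case True
      then have "nonoverlapping (snd (snd a)) (snd (snd b))"
        using that by (intro \<pi>D(6)) (auto simp: A_def prod_eq_iff)
      then show ?thesis by (rule nonoverlapping_subset) (auto simp: B_def)
    next
      case False
      then have "nonoverlapping (fst a) (fst b)"
        by (intro pairwiseD[OF \<K>(3)]) (use that(1,2) in \<open>auto simp: A_def\<close>)
      then show ?thesis by (rule nonoverlapping_subset) (auto simp: B_def)
    qed
    have box: "is_box (B a)" if "a \<in> A" for a
      using that K(1) \<pi>D(2) unfolding A_def B_def by (auto intro!: is_box_Int)
    have fineD: "snd p \<subseteq> max_ball (fst p) (\<delta> (fst p))" "snd p \<subseteq> max_ball (fst p) (\<rho> (fst p))" 
      if "p \<in> \<pi>" for p
      by (rule fine_partitionD[OF \<pi>(2) that], rule fine_partitionD[OF \<pi>(3) that])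
    have 1: "norm (\<Sum>a\<in>A. measure lebesgue (B a) *\<^sub>R f (fst (snd a)) - nondeg_ext F (B a)) < \<epsilon> / 2"
    proof (rule henstock_primitive_family[OF \<delta>(2) A no box])
      fix a assume a: "a \<in> A"
      then have p: "snd a \<in> \<pi>" by (auto simp: A_def)
      show "fst (snd a) \<in> W" by (rule \<pi>D(4)[OF p])
      show "B a \<subseteq> W" "B a \<subseteq> max_ball (fst (snd a)) (\<delta> (fst (snd a)))"
        using \<pi>D(3)[OF p] fineD(1)[OF p] by (auto simp: B_def)
    qed
    have 2: "(\<Sum>a\<in>A. nondeg_ext F (B a)) = (\<Sum>K\<in>\<K>. F K)"
    proof -
      have "(\<Sum>a\<in>A. nondeg_ext F (B a)) = (\<Sum>k\<in>\<K>. \<Sum>p\<in>\<pi>. nondeg_ext F (k \<inter> snd p))"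
        by (simp add: A_def B_def sum.cartesian_product case_prod_beta)
      also have "\<dots> = (\<Sum>K\<in>\<K>. F K)"
      proof (rule sum.cong[OF refl])
        fix k assume k: "k \<in> \<K>"
        show "(\<Sum>p\<in>\<pi>. nondeg_ext F (k \<inter> snd p)) = F k"
        proof (rule additive_family[OF F K(2,3)[OF k] \<pi>D(1)])
          show "is_box (k \<inter> snd p)" if "p \<in> \<pi>" for p using K(1)[OF k] \<pi>D(2)[OF that] by (rule is_box_Int)
          show "nonoverlapping (k \<inter> snd p) (k \<inter> snd q)" if "p \<in> \<pi>" "q \<in> \<pi>" "p \<noteq> q" for p q
            by (rule nonoverlapping_subset[OF \<pi>D(6)[OF that]]) auto
          have "(\<Union>p\<in>\<pi>. k \<inter> snd p) = k \<inter> (\<Union>(t,I)\<in>\<pi>. I)" by auto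
          then show "(\<Union>p\<in>\<pi>. k \<inter> snd p) = k" unfolding \<pi>W using K(2)[OF k] by blast
        qed
      qed
      finally show ?thesis .
    qed
    have 3: "norm (\<Sum>a\<in>A. measure lebesgue (B a) *\<^sub>R f (fst (snd a))) \<le> \<eta> * M"
    proof -
      have "(\<Sum>a\<in>A. measure lebesgue (B a) *\<^sub>R f (fst (snd a))) =
          (\<Sum>k\<in>\<K>. \<Sum>p\<in>\<pi>. measure lebesgue (k \<inter> snd p) *\<^sub>R f (fst p))"
        by (simp add: A_def B_def sum.cartesian_product case_prod_beta)
      \<comment> \<open>Collected by tag, the measures add up before the norm is taken, and one
        bound \<eta> serves for each tag.\<close>
      also have "\<dots> = (\<Sum>p\<in>\<pi>. \<Sum>k\<in>\<K>. measure lebesgue (k \<inter> snd p) *\<^sub>R f (fst p))"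
        by (rule sum.swap)
      also have "\<dots> = (\<Sum>p\<in>\<pi>. (\<Sum>k\<in>\<K>. measure lebesgue (k \<inter> snd p)) *\<^sub>R f (fst p))"
        by (simp add: scaleR_sum_left)
      also have "norm \<dots> \<le> (\<Sum>p\<in>\<pi>. \<eta> * norm (f (fst p)))"
      proof (rule order_trans[OF norm_sum], rule sum_mono)
        fix p assume p: "p \<in> \<pi>"
        show "norm ((\<Sum>k\<in>\<K>. measure lebesgue (k \<inter> snd p)) *\<^sub>R f (fst p)) \<le> \<eta> * norm (f (fst p))"
        proof (cases "fst p \<in> U")
          case True
          have "(\<Sum>k\<in>\<K>. measure lebesgue (k \<inter> snd p)) \<le> measure lebesgue (\<Union>\<K> \<inter> U)"
          proof (rule measure_nonoverlapping_le[OF \<K>(1)])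
            fix k assume k: "k \<in> \<K>"
            show "is_box (k \<inter> snd p)" using K(1)[OF k] \<pi>D(2)[OF p] by (rule is_box_Int)
            show "k \<inter> snd p \<subseteq> \<Union>\<K> \<inter> U" using k \<rho>(2)[OF True] fineD(2)[OF p] by blast
            fix k' assume "k' \<in> \<K>" "k \<noteq> k'"
            then have "nonoverlapping k k'" using k \<K>(3) by (auto simp: pairwise_def)
            then show "nonoverlapping (k \<inter> snd p) (k' \<inter> snd p)" 
              by (rule nonoverlapping_subset) auto
          next
            have "\<Union>\<K> \<in> lmeasurable" using \<K>(1) K(1) by (intro fmeasurable.finite_Union) (auto intro: is_box_lmeasurable)
            moreover have "U \<in> sets lebesgue" using U(1) by simp
            ultimately show "\<Union>\<K> \<inter> U \<in> lmeasurable" by (rule fmeasurable_Int_fmeasurable)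
          qed
          then have "(\<Sum>k\<in>\<K>. measure lebesgue (k \<inter> snd p)) \<le> \<eta>" using small by linarith
          then show ?thesis by (simp add: mult_right_mono sum_nonneg)
        next
          case False
          then have "f (fst p) = 0" using U(2) \<pi>D(4)[OF p] by blast
          then show ?thesis by simp
        qed
      qed
      also have "\<dots> = \<eta> * M" by (simp add: M_def sum_distrib_left)
      finally show ?thesis .
    qed
    have eq: "(\<Sum>K\<in>\<K>. F K) = (\<Sum>a\<in>A. measure lebesgue (B a) *\<^sub>R f (fst (snd a))) -
        (\<Sum>a\<in>A. measure lebesgue (B a) *\<^sub>R f (fst (snd a)) - nondeg_ext F (B a))"
      using 2 by (simp add: sum_subtractf)
    show ?thesis
      unfolding eq using 1 3 \<eta>(2) 
        norm_triangle_ineq4[of "\<Sum>a\<in>A. measure lebesgue (B a) *\<^sub>R f (fst (snd a))"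
          "\<Sum>a\<in>A. measure lebesgue (B a) *\<^sub>R f (fst (snd a)) - nondeg_ext F (B a)"]
      by linarith
  qed
  then show ?thesis using \<eta>(1) by blast
qed

lemma divisions_inD:
  assumes "D \<in> divisions_in E"
  shows "is_box (D k)" "D k \<subseteq> E" "D k \<in> nondeg_intervals" "j \<noteq> k \<Longrightarrow> nonoverlapping (D j) (D k)"
  using assms by (auto simp: divisions_in_def intervals_in_def nondeg_is_box)

lemma divisions_in_mono: "D \<in> divisions_in E \<Longrightarrow> E \<subseteq> E' \<Longrightarrow> D \<in> divisions_in E'"
  unfolding divisions_in_def intervals_in_def by blast

text \<open>The members do not overlap and lie in a bounded set, so their measures form a convergent
  series.\<close>

lemma division_tail_measure:
  fixes D :: "nat \<Rightarrow> (real^'m) set"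
  assumes D: "D \<in> divisions_in E" and E: "bounded E" and \<eta>: "\<eta> > 0"
  shows "\<exists>N. (\<Union>k. D (k + N)) \<in> lmeasurable \<and> measure lebesgue (\<Union>k. D (k + N)) < \<eta>"
proof -
  have m: "(\<Union>k. D (k + N)) \<in> lmeasurable \<and>
      (\<lambda>k. measure lebesgue (D (k + N))) sums measure lebesgue (\<Union>k. D (k + N))" for N
  proof -
    have a: "D (k + N) \<in> lmeasurable" for k by (rule is_box_lmeasurable[OF divisions_inD(1)[OF D]])
    have b: "pairwise (\<lambda>j k. negligible (D (j + N) \<inter> D (k + N))) UNIV"
      unfolding pairwise_def
    proof (intro ballI impI)
      fix j k :: nat assume "j \<noteq> k"
      then show "negligible (D (j + N) \<inter> D (k + N))"
        by (intro negligible_Int_nonoverlapping divisions_inD[OF D]) auto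
    qed
    have c: "bounded (\<Union>k. D (k + N))"
      by (rule bounded_subset[OF E]) (use divisions_inD(2)[OF D] in blast)
    show ?thesis
      using measurable_countable_negligible_Union_bounded[OF a b c]
        measure_countable_negligible_Union_bounded[OF a b c] by blast
  qed
  have "summable (\<lambda>k. measure lebesgue (D k))" using m[of 0] by (auto simp: sums_iff)
  then obtain N where "norm (\<Sum>k. measure lebesgue (D (k + N))) < \<eta>"
    using suminf_exist_split[OF \<eta>] by blast
  then have "measure lebesgue (\<Union>k. D (k + N)) < \<eta>" using m[of N] by (simp add: sums_iff)
  then show ?thesis using m[of N] by blast
qed

lemma is_box_Int_division:
  assumes "is_box I" "D \<in> divisions_in E"
  shows "is_box (I \<inter> D k)" "j \<noteq> k \<Longrightarrow> nonoverlapping (I \<inter> D j) (I \<inter> D k)"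
  using is_box_Int[OF assms(1) divisions_inD(1)[OF assms(2)]]
    nonoverlapping_subset[OF divisions_inD(4)[OF assms(2)]] by auto

text \<open>The Cauchy criterion for unconditional convergence, stated for finite sets disjoint from
  \<open>P\<close> because these are what a tail estimate controls. Completeness of the space enters
  here.\<close>

lemma summable_on_Cauchy_disjoint:
  fixes f :: "'a \<Rightarrow> 'x::banach"
  assumes "\<And>\<epsilon>. \<epsilon> > 0 \<Longrightarrow> \<exists>P. finite P \<and> P \<subseteq> A \<and> (\<forall>M. finite M \<and> M \<subseteq> A - P \<longrightarrow> norm (sum f M) < \<epsilon>)"
  shows "f summable_on A"
proof -
  have "\<exists>P. eventually P (finite_subsets_at_top A) \<and>
      (\<forall>F1 F2. P F1 \<and> P F2 \<longrightarrow> dist (sum f F1) (sum f F2) < \<epsilon>)" if \<epsilon>: "\<epsilon> > 0" for \<epsilon>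
  proof -
    obtain P where P: "finite P" "P \<subseteq> A" "\<forall>M. finite M \<and> M \<subseteq> A - P \<longrightarrow> norm (sum f M) < \<epsilon> / 2"
      using assms[of "\<epsilon> / 2"] \<epsilon> by auto
    show ?thesis
    proof (intro exI conjI allI impI)
      show "eventually (\<lambda>M. finite M \<and> P \<subseteq> M \<and> M \<subseteq> A) (finite_subsets_at_top A)"
        using P(1,2) by (auto simp: eventually_finite_subsets_at_top)
      fix F1 F2 assume F: "(finite F1 \<and> P \<subseteq> F1 \<and> F1 \<subseteq> A) \<and> (finite F2 \<and> P \<subseteq> F2 \<and> F2 \<subseteq> A)"
      \<comment> \<open>Two finite sets containing \<open>P\<close> share this part, so it cancels
        in the difference of their sums.\<close>
      have "sum f M = sum f P + sum f (M - P)" if "finite M" "P \<subseteq> M" for M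
        using sum.subset_diff[OF that(2,1), of f] by (simp add: add.commute)
      then have eq: "sum f F1 - sum f F2 = sum f (F1 - P) - sum f (F2 - P)" using F by simp
      have "norm (sum f (F1 - P)) < \<epsilon> / 2" "norm (sum f (F2 - P)) < \<epsilon> / 2"
        using P(3)[rule_format, of "F1 - P"] P(3)[rule_format, of "F2 - P"] F by auto
      then show "dist (sum f F1) (sum f F2) < \<epsilon>"
        unfolding dist_norm eq by (rule norm_diff_less_halves)
    qed
  qed
  then have "cauchy_filter (filtermap (sum f) (finite_subsets_at_top A))"
    by (simp add: cauchy_filter_metric_filtermap)
  moreover have "complete (UNIV::'x set)"
    by (meson Cauchy_convergent UNIV_I complete_def convergent_def)
  ultimately obtain L where "(sum f \<longlongrightarrow> L) (finite_subsets_at_top A)"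
    using complete_uniform[where S=UNIV] by (force simp: filterlim_def)
  then show ?thesis unfolding summable_on_def has_sum_def by blast
qed

text \<open>Relative continuity with \<open>U = UNIV\<close>: any finite set of members beyond
  \<open>N\<close> lies in a tail of small measure.\<close>

lemma henstock_primitive_summable:
  fixes f :: "real^'m \<Rightarrow> 'x::banach"
  assumes W: "W \<in> nondeg_intervals" and F: "additive_interval_fun F W"
    and f: "henstock_primitive f F W" and D: "D \<in> divisions_in W" and I: "is_box I"
  shows "(\<lambda>k. nondeg_ext F (I \<inter> D k)) summable_on UNIV"
proof (rule summable_on_Cauchy_disjoint)
  fix \<epsilon> :: real assume \<epsilon>: "\<epsilon> > 0"
  have bW: "bounded W" using nondeg_is_box[OF W] by (auto elim: is_boxE)
  obtain \<eta> where \<eta>: "\<eta> > 0" "\<forall>\<K>. finite \<K> \<and> \<K> \<subseteq> intervals_in W \<and> pairwise nonoverlapping \<K> \<and>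
      measure lebesgue (\<Union>\<K> \<inter> UNIV) < \<eta> \<longrightarrow> norm (\<Sum>K\<in>\<K>. F K) < \<epsilon>"
    using henstock_relative_continuity[OF W F f open_UNIV _ \<epsilon>] by blast
  obtain N where N: "(\<Union>k. D (k + N)) \<in> lmeasurable" "measure lebesgue (\<Union>k. D (k + N)) < \<eta>"
    using division_tail_measure[OF D bW \<eta>(1)] by blast
  have "norm (\<Sum>k\<in>M. nondeg_ext F (I \<inter> D k)) < \<epsilon>" if M: "finite M" "M \<subseteq> UNIV - {..<N}" for M
  proof -
    define \<K> where "\<K> = (\<lambda>k. I \<inter> D k) ` {k \<in> M. I \<inter> D k \<in> nondeg_intervals}"
    have K1: "finite \<K>" "\<K> \<subseteq> intervals_in W"
      using M(1) divisions_inD(2)[OF D] by (auto simp: \<K>_def intervals_in_def)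
    have K2: "pairwise nonoverlapping \<K>"
      unfolding \<K>_def by (intro pairwise_imageI is_box_Int_division(2)[OF I D])
    have sub: "\<Union>\<K> \<subseteq> (\<Union>k. D (k + N))"
    proof
      fix x assume "x \<in> \<Union>\<K>"
      then obtain k where k: "k \<in> M" "x \<in> D k" by (auto simp: \<K>_def)
      then have "k \<ge> N" using M(2) by auto
      then show "x \<in> (\<Union>k. D (k + N))" using k by (intro UN_I[of "k - N"]) auto
    qed
    have "\<Union>\<K> \<in> sets lebesgue"
      using K1 by (intro sets.finite_Union) (auto simp: intervals_in_def intro!: fmeasurableD is_box_lmeasurable nondeg_is_box)
    then have "measure lebesgue (\<Union>\<K>) \<le> measure lebesgue (\<Union>k. D (k + N))"
      using sub N(1) by (intro measure_mono_fmeasurable)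
    then have "norm (\<Sum>K\<in>\<K>. F K) < \<epsilon>" using \<eta>(2) K1 K2 N(2) by auto
    moreover have "(\<Sum>K\<in>\<K>. F K) = (\<Sum>k\<in>M. nondeg_ext F (I \<inter> D k))"
    proof -
      have "(\<Sum>K\<in>\<K>. F K) = (\<Sum>K\<in>\<K>. nondeg_ext F K)"
        by (intro sum.cong) (auto simp: \<K>_def nondeg_ext_def)
      also have "\<dots> = (\<Sum>k\<in>M. nondeg_ext F (I \<inter> D k))"
        unfolding \<K>_def by (rule sum_image_nondeg[OF M(1) is_box_Int_division(2)[OF I D]])
      finally show ?thesis .
    qed
    ultimately show ?thesis by simp
  qed
  then show "\<exists>P. finite P \<and> P \<subseteq> UNIV \<and> (\<forall>M. finite M \<and> M \<subseteq> UNIV - P \<longrightarrow>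
      norm (\<Sum>k\<in>M. nondeg_ext F (I \<inter> D k)) < \<epsilon>)"
    by (intro exI[of _ "{..<N}"]) auto
qed

text \<open>The remainder \<open>Q\<close> of \<open>I\<close> after the pieces
  \<open>I \<inter> D k\<close> with \<open>k\<close> in \<open>M\<close> may be large outside
  \<open>U\<close>. Inside \<open>U\<close> it is covered, up to a null set, by the tail of
  \<open>D\<close>, and since \<open>f\<close> vanishes off \<open>U\<close> only that part
  matters.\<close>

lemma henstock_primitive_has_sum:
  fixes f :: "real^'m \<Rightarrow> 'x::banach"
  assumes W: "W \<in> nondeg_intervals" and F: "additive_interval_fun F W"
    and f: "henstock_primitive f F W" and U: "open U" "U \<subseteq> W" "\<And>t. t \<in> W - U \<Longrightarrow> f t = 0"
    and D: "D \<in> divisions_of U" and I: "I \<in> intervals_in W"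
  shows "((\<lambda>k. nondeg_ext F (I \<inter> D k)) has_sum F I) UNIV"
  unfolding has_sum_def tendsto_iff eventually_finite_subsets_at_top
proof (intro allI impI)
  fix \<epsilon> :: real assume \<epsilon>: "\<epsilon> > 0"
  have In: "I \<in> nondeg_intervals" "I \<subseteq> W" "is_box I" using I by (auto simp: intervals_in_def nondeg_is_box)
  have bW: "bounded W" using nondeg_is_box[OF W] by (auto elim: is_boxE)
  have D1: "D \<in> divisions_in U" and D2: "(\<Union>k. D k) = U" using D by (auto simp: divisions_of_def)
  obtain \<eta> where \<eta>: "\<eta> > 0" "\<forall>\<K>. finite \<K> \<and> \<K> \<subseteq> intervals_in W \<and> pairwise nonoverlapping \<K> \<and>
      measure lebesgue (\<Union>\<K> \<inter> U) < \<eta> \<longrightarrow> norm (\<Sum>K\<in>\<K>. F K) < \<epsilon>"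
    using henstock_relative_continuity[OF W F f U(1,3) \<epsilon>] by blast
  obtain N where N: "(\<Union>k. D (k + N)) \<in> lmeasurable" "measure lebesgue (\<Union>k. D (k + N)) < \<eta>"
    using division_tail_measure[OF D1 bounded_subset[OF bW U(2)] \<eta>(1)] by blast
  have "dist (\<Sum>k\<in>M. nondeg_ext F (I \<inter> D k)) (F I) < \<epsilon>" if M: "finite M" "{..<N} \<subseteq> M" for M
  proof -
    obtain Q where Q: "finite Q" "Q \<subseteq> intervals_in I" "pairwise nonoverlapping Q"
      "\<forall>k\<in>M. \<forall>J\<in>Q. nonoverlapping (I \<inter> D k) J"
      "(\<lambda>k. I \<inter> D k) ` {k \<in> M. I \<inter> D k \<in> nondeg_intervals} \<union> Q division_of I"
      "(\<lambda>k. I \<inter> D k) ` {k \<in> M. I \<inter> D k \<in> nondeg_intervals} \<inter> Q = {}"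
      by (rule division_complement[OF In(1) M(1), of "\<lambda>k. I \<inter> D k",
          OF is_box_Int_division(1)[OF In(3) D1] is_box_Int_division(2)[OF In(3) D1]]) auto
    have Qb: "J \<in> nondeg_intervals" "J \<subseteq> I" "is_box J" if "J \<in> Q" for J 
      using Q(2) that by (auto simp: intervals_in_def nondeg_is_box)
    have "nondeg_ext F I = (\<Sum>k\<in>M. nondeg_ext F (I \<inter> D k)) + (\<Sum>J\<in>Q. F J)"
      by (rule additive_complement[OF F In(2,3) M(1) is_box_Int_division(2)[OF In(3) D1] Q(5,6)])
        (use Qb in auto)
    then have eq: "F I - (\<Sum>k\<in>M. nondeg_ext F (I \<inter> D k)) = (\<Sum>J\<in>Q. F J)"
      using In(1) by (simp add: nondeg_ext_def)
    \<comment> \<open>The common boundary points of \<open>Q\<close> and of the removed pieces: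
      \<open>Q\<close> does not overlap these pieces but may touch them.\<close>
    define Z where "Z = (\<Union>k\<in>M. \<Union>J\<in>Q. (I \<inter> D k) \<inter> J)"
    have neg: "negligible (I \<inter> D k \<inter> J)" if "k \<in> M" "J \<in> Q" for k J
      using negligible_Int_nonoverlapping[OF is_box_Int_division(1)[OF In(3) D1] Qb(3)[OF that(2)]]
        Q(4) that by blast
    have "negligible (\<Union>J\<in>Q. I \<inter> D k \<inter> J)" if "k \<in> M" for k
      by (rule negligible_Union[OF finite_imageI[OF Q(1)]]) (use neg[OF that] in blast)
    then have Z: "negligible Z"
      unfolding Z_def by (intro negligible_Union[OF finite_imageI[OF M(1)]]) blast
    have sub: "\<Union>Q \<inter> U \<subseteq> (\<Union>k. D (k + N)) \<union> Z"
    proof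
      fix x assume "x \<in> \<Union>Q \<inter> U"
      then obtain J k where x: "J \<in> Q" "x \<in> J" "x \<in> D k" using D2 by blast
      show "x \<in> (\<Union>k. D (k + N)) \<union> Z"
      proof (cases "k \<in> M")
        case True
        then show ?thesis using x Qb(2)[OF x(1)] by (auto simp: Z_def)
      next
        case False
        then have "k \<ge> N" using M(2) by (meson lessThan_iff not_le subsetD)
        then have "x \<in> (\<Union>k. D (k + N))" using x by (intro UN_I[of "k - N"]) auto
        then show ?thesis by blast
      qed
    qed
    have "\<Union>Q \<in> sets lebesgue"
      using Q(1) Qb by (intro sets.finite_Union) (auto intro!: fmeasurableD is_box_lmeasurable)
    then have mQ: "\<Union>Q \<inter> U \<in> sets lebesgue" by (rule sets.Int) (use U(1) in simp)
    have Zn: "Z \<in> null_sets lebesgue" using Z by (simp add: negligible_iff_null_sets)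
    have "measure lebesgue (\<Union>Q \<inter> U) \<le> measure lebesgue ((\<Union>k. D (k + N)) \<union> Z)"
      using sub mQ N(1) Z by (intro measure_mono_fmeasurable fmeasurable.Un)
        (auto simp: negligible_imp_measurable)
    also have "\<dots> = measure lebesgue (\<Union>k. D (k + N))"
      using N(1) Zn by (intro measure_Un_null_set) (auto dest: fmeasurableD)
    finally have "measure lebesgue (\<Union>Q \<inter> U) < \<eta>" using N(2) by linarith
    moreover have "Q \<subseteq> intervals_in W" using Q(2) In(2) by (auto simp: intervals_in_def)
    ultimately have "norm (\<Sum>J\<in>Q. F J) < \<epsilon>" using \<eta>(2) Q(1,3) by blast
    then show ?thesis unfolding eq[symmetric] by (simp add: dist_norm norm_minus_commute)
  qed
  then show "\<exists>X. finite X \<and> X \<subseteq> UNIV \<and> (\<forall>Y. finite Y \<and> X \<subseteq> Y \<and> Y \<subseteq> UNIV \<longrightarrow>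
      dist (\<Sum>k\<in>Y. nondeg_ext F (I \<inter> D k)) (F I) < \<epsilon>)"
    by (intro exI[of _ "{..<N}"]) auto
qed

subsection \<open>Divisions of open sets\<close>

lemma open_interval_around:
  fixes x :: "real^'m"
  assumes "open U" "x \<in> U"
  shows "\<exists>B\<in>intervals_in U. x \<in> interior B"
proof -
  obtain a b where ab: "cbox a b \<subseteq> U" "x \<in> box a b" 
    using open_contains_cbox[OF assms] by metis
  then have "cbox a b \<in> intervals_in U" by (auto simp: intervals_in_def nondeg_intervals_iff)
  then show ?thesis using ab by (intro bexI[of _ "cbox a b"]) auto
qed

text \<open>Every box given by \<open>covering_lemma\<close> lies in \<open>J\<close> and within the
  gauge of one of its own points that belongs to \<open>U\<close>. With \<open>U\<close> as the
  gauge at such points, the boxes cannot leave \<open>U\<close>, so they fill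
  \<open>U \<inter> J\<close> exactly.\<close>

lemma open_Int_box_cover:
  fixes J :: "(real^'m) set"
  assumes J: "J \<in> nondeg_intervals" and U: "open U"
  shows "\<exists>\<D>. countable \<D> \<and> \<D> \<subseteq> nondeg_intervals \<and> \<Union>\<D> = U \<inter> J \<and> pairwise nonoverlapping \<D>"
proof -
  obtain c d where cd: "J = cbox c d" using nondeg_is_box[OF J] by (rule is_boxE)
  have ne: "box c d \<noteq> {}" using J by (simp add: cd nondeg_intervals_iff)
  define g where "g x = (if x \<in> U then U else UNIV)" for x
  have g: "gauge g" using U by (auto simp: gauge_def g_def)
  obtain \<D> where \<D>: "countable \<D>" "\<Union>\<D> \<subseteq> cbox c d"
    "\<And>K. K \<in> \<D> \<Longrightarrow> interior K \<noteq> {} \<and> (\<exists>c d. K = cbox c d)"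
    "pairwise (\<lambda>A B. interior A \<inter> interior B = {}) \<D>"
    "\<And>K. K \<in> \<D> \<Longrightarrow> \<exists>x \<in> (U \<inter> J) \<inter> K. K \<subseteq> g x" "U \<inter> J \<subseteq> \<Union>\<D>"
    by (rule covering_lemma[OF _ ne g, of "U \<inter> J"]) (simp_all add: cd)
  have "K \<subseteq> U" if "K \<in> \<D>" for K using \<D>(5)[OF that] by (auto simp: g_def split: if_splits)
  then have "\<Union>\<D> = U \<inter> J" using \<D>(2,6) cd by blast
  moreover have "\<D> \<subseteq> nondeg_intervals"
    using \<D>(3) by (auto simp: nondeg_intervals_iff is_box_def)
  moreover have "pairwise nonoverlapping \<D>" using \<D>(4) by (auto simp: pairwise_def nonoverlapping_def)
  ultimately show ?thesis using \<D>(1) by blast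
qed

text \<open>Cut a large box around \<open>U\<close> into \<open>B\<close> and finitely many other
  intervals, and fill the part of \<open>U\<close> in each of the latter. Besides making every
  interval in \<open>U\<close> accessible to the third condition of the theorem, this shows that
  divisions of \<open>U\<close> exist at all.\<close>

lemma division_containing_interval:
  fixes U :: "(real^'m) set"
  assumes U: "open U" "bounded U" and B: "B \<in> intervals_in U"
  shows "\<exists>D\<in>divisions_of U. B \<in> range D"
proof -
  obtain a where "U \<subseteq> cbox (-a) a" using bounded_subset_cbox_symmetric[OF U(2)] by blast
  then obtain W where W: "is_box W" "U \<subseteq> W" using is_box_cbox by blast
  have Bn: "B \<in> nondeg_intervals" "B \<subseteq> U" "is_box B"
    using B by (auto simp: intervals_in_def nondeg_is_box)
  have "interior B \<subseteq> interior W" using Bn W by (intro interior_mono) blast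
  then have Wn: "W \<in> nondeg_intervals" using Bn(1) W(1) by (auto simp: nondeg_intervals_iff)
  obtain Q where Q: "finite Q" "Q \<subseteq> intervals_in W" "pairwise nonoverlapping Q"
    "\<forall>a\<in>{B}. \<forall>J\<in>Q. nonoverlapping a J"
    "(\<lambda>x. x) ` {a \<in> {B}. a \<in> nondeg_intervals} \<union> Q division_of W"
    "(\<lambda>x. x) ` {a \<in> {B}. a \<in> nondeg_intervals} \<inter> Q = {}"
    by (rule division_complement[OF Wn, of "{B}" "\<lambda>x. x"]) (use Bn W in auto)
  have W_eq: "B \<union> \<Union>Q = W" using division_ofD(6)[OF Q(5)] Bn(1) by auto
  have "\<forall>J\<in>Q. \<exists>\<D>. countable \<D> \<and> \<D> \<subseteq> nondeg_intervals \<and> \<Union>\<D> = U \<inter> J \<and> pairwise nonoverlapping \<D>"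
    using open_Int_box_cover[OF _ U(1)] Q(2) by (auto simp: intervals_in_def)
  then obtain \<D> where \<D>: "\<And>J. J \<in> Q \<Longrightarrow> countable (\<D> J)" "\<And>J. J \<in> Q \<Longrightarrow> \<D> J \<subseteq> nondeg_intervals"
    "\<And>J. J \<in> Q \<Longrightarrow> \<Union>(\<D> J) = U \<inter> J" "\<And>J. J \<in> Q \<Longrightarrow> pairwise nonoverlapping (\<D> J)" by metis
  define \<C> where "\<C> = insert B (\<Union>J\<in>Q. \<D> J)"
  have count: "countable \<C>" using \<D>(1) Q(1) by (auto simp: \<C>_def countable_finite)
  have sub: "K \<subseteq> J" if "J \<in> Q" "K \<in> \<D> J" for J K using \<D>(3)[OF that(1)] that(2) by blast
  have int: "\<C> \<subseteq> intervals_in U"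
    using B \<D>(2,3) unfolding \<C>_def intervals_in_def by blast
  have "\<Union>\<C> = B \<union> (\<Union>J\<in>Q. \<Union>(\<D> J))" unfolding \<C>_def by blast
  also have "\<dots> = B \<union> (\<Union>J\<in>Q. U \<inter> J)" using \<D>(3) by simp
  also have "\<dots> = U" using W_eq W(2) Bn(2) by blast
  finally have UC: "\<Union>\<C> = U" .
  have no: "nonoverlapping K L" if KL: "K \<in> \<C>" "L \<in> \<C>" "K \<noteq> L" for K L
  proof -
    have BJ: "nonoverlapping B M" if "J \<in> Q" "M \<in> \<D> J" for J M
      using nonoverlapping_subset[OF _ order_refl sub[OF that]] Q(4) that(1) by blast
    consider "K = B" "L = B" | J where "K = B" "J \<in> Q" "L \<in> \<D> J" | J where "L = B" "J \<in> Q" "K \<in> \<D> J"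
      | J J' where "J \<in> Q" "K \<in> \<D> J" "J' \<in> Q" "L \<in> \<D> J'"
      using KL(1,2) unfolding \<C>_def by blast
    then show ?thesis
    proof cases
      case 1
      then show ?thesis using KL(3) by simp
    next
      case 2
      then show ?thesis using BJ by simp
    next
      case 3
      then show ?thesis using BJ nonoverlapping_sym by blast
    next
      case (4 J J')
      show ?thesis
      proof (cases "J = J'")
        case True
        then show ?thesis using pairwiseD[OF \<D>(4)[OF 4(1)] 4(2)] 4(4) KL(3) by blast
      next
        case False
        then have "nonoverlapping J J'" by (rule pairwiseD[OF Q(3) 4(1,3)])
        then show ?thesis using sub[OF 4(1,2)] sub[OF 4(3,4)] by (rule nonoverlapping_subset)
      qed
    qed
  qed
  \<comment> \<open>A division is a sequence without repetition, so the collection must be infinite.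
    A finite one would make \<open>U\<close> closed as well as open, hence empty or
    unbounded.\<close>
  have inf: "infinite \<C>"
  proof
    assume "finite \<C>"
    moreover have "closed K" if "K \<in> \<C>" for K
    proof -
      have "is_box K" using that int nondeg_is_box by (auto simp: intervals_in_def)
      then show ?thesis by (auto elim: is_boxE)
    qed
    ultimately have "closed U" using UC by (metis closed_Union)
    then have "U = {} \<or> U = UNIV" using U(1) clopen by blast
    moreover have "U \<noteq> {}" using Bn by (auto simp: nondeg_intervals_iff)
    ultimately show False using U(2) not_bounded_UNIV by blast
  qed
  define D where "D = from_nat_into \<C>"
  have bij: "bij_betw D UNIV \<C>" unfolding D_def by (rule bij_betw_from_nat_into[OF count inf])
  then have range: "range D = \<C>" and inj: "inj D" by (auto simp: bij_betw_def)
  have "D \<in> divisions_of U"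
    unfolding divisions_of_def divisions_in_def
  proof (intro CollectI conjI allI impI)
    show "D k \<in> intervals_in U" for k using int range by blast
    show "nonoverlapping (D j) (D k)" if "j \<noteq> k" for j k
      using no[of "D j" "D k"] that inj range by (auto simp: inj_def)
    show "(\<Union>k. D k) = U" using range UC by simp
  qed
  moreover have "B \<in> range D" using range by (simp add: \<C>_def)
  ultimately show ?thesis by blast
qed

text \<open>Each tag lies in the interior of its assigned interval, so a gauge can push the
  intervals tagged there into that same interval. The pairs assigned to \<open>B k\<close> thus form
  a partition in \<open>B k\<close>, where the hypothesis applies.\<close>

lemma henstock_primitive_open:
  fixes U :: "(real^'m) set" and f :: "real^'m \<Rightarrow> 'x::real_normed_vector"
  assumes U: "open U" and f: "\<And>B. B \<in> intervals_in U \<Longrightarrow> henstock_primitive f F B"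
  shows "henstock_primitive f F U"
proof (cases "U = {}")
  case True
  then have empty: "\<pi> = {}" if "M_partition_in \<pi> U" for \<pi> using that by (auto simp: M_partition_in_def)
  have "norm (\<Sum>(t, I)\<in>\<pi>. measure lebesgue I *\<^sub>R f t - F I) < \<epsilon>"
    if "M_partition_in \<pi> U" "\<epsilon> > 0" for \<pi> \<epsilon> using empty[OF that(1)] that(2) by simp
  moreover have "gauge_on U (\<lambda>_. 1)" by (simp add: gauge_on_def)
  ultimately show ?thesis unfolding henstock_primitive_def by blast
next
  case ne: False
  obtain \<F> where \<F>: "\<F> \<subseteq> interior ` intervals_in U" "countable \<F>" "\<Union>\<F> = \<Union>(interior ` intervals_in U)"
    by (rule Lindelof[of "interior ` intervals_in U"]) auto
  obtain \<B> where \<B>: "countable \<B>" "\<B> \<subseteq> intervals_in U" "\<F> = interior ` \<B>"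
    using \<F>(1,2) countable_subset_image by metis
  have cover: "\<exists>B\<in>\<B>. t \<in> interior B" if "t \<in> U" for t
    using open_interval_around[OF U that] \<F>(3) \<B>(3) by blast
  then have "\<B> \<noteq> {}" using ne by blast
  define B where "B = from_nat_into \<B>"
  have range: "range B = \<B>" unfolding B_def by (rule range_from_nat_into) fact+
  have BU: "B n \<in> intervals_in U" for n using range \<B>(2) by blast
  \<comment> \<open>Taking the least index assigns each tag to exactly one of the possibly
    overlapping intervals \<open>B k\<close>.\<close>
  define n where "n t = (LEAST k. t \<in> interior (B k))" for t
  have n: "t \<in> interior (B (n t))" if t: "t \<in> U" for t
  proof -
    obtain k where "t \<in> interior (B k)" using cover[OF t] range by blast
    then show ?thesis unfolding n_def by (rule LeastI)
  qed
  show ?thesis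
    unfolding henstock_primitive_def
  proof (intro allI impI)
    fix \<epsilon> :: real assume \<epsilon>: "\<epsilon> > 0"
    have ex: "\<exists>\<delta>. gauge_on (B k) \<delta> \<and> (\<forall>\<pi>. M_partition_in \<pi> (B k) \<and> fine_partition \<delta> \<pi> \<longrightarrow>
        norm (\<Sum>(t, I)\<in>\<pi>. measure lebesgue I *\<^sub>R f t - F I) < \<epsilon> / 2 ^ (k + 2))" for k
    proof -
      have "\<epsilon> / 2 ^ (k + 2) > 0" using \<epsilon> by simp
      then show ?thesis using f[OF BU] unfolding henstock_primitive_def by blast
    qed
    have "\<exists>\<delta>. \<forall>k. gauge_on (B k) (\<delta> k) \<and> (\<forall>\<pi>. M_partition_in \<pi> (B k) \<and> fine_partition (\<delta> k) \<pi> \<longrightarrow>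
        norm (\<Sum>(t, I)\<in>\<pi>. measure lebesgue I *\<^sub>R f t - F I) < \<epsilon> / 2 ^ (k + 2))"
      by (intro choice allI ex)
    then obtain \<delta> where \<delta>: "\<And>k. gauge_on (B k) (\<delta> k)"
      "\<And>k. \<forall>\<pi>. M_partition_in \<pi> (B k) \<and> fine_partition (\<delta> k) \<pi> \<longrightarrow>
        norm (\<Sum>(t, I)\<in>\<pi>. measure lebesgue I *\<^sub>R f t - F I) < \<epsilon> / 2 ^ (k + 2)" by blast
    have "\<exists>r>0. t \<in> U \<longrightarrow> max_ball t r \<subseteq> interior (B (n t))" for t
      using max_ball_in_open[OF open_interior n, of t] zero_less_one by blast
    then obtain \<rho> where \<rho>: "\<And>t. \<rho> t > 0" "\<And>t. t \<in> U \<Longrightarrow> max_ball t (\<rho> t) \<subseteq> interior (B (n t))" by metis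
    have int: "interior (B k) \<subseteq> B k" for k by (rule interior_subset)
    show "\<exists>\<delta>. gauge_on U \<delta> \<and> (\<forall>\<pi>. M_partition_in \<pi> U \<and> fine_partition \<delta> \<pi> \<longrightarrow>
        norm (\<Sum>(t, I)\<in>\<pi>. measure lebesgue I *\<^sub>R f t - F I) < \<epsilon>)"
    proof (intro exI conjI allI impI)
      show "gauge_on U (\<lambda>t. min (\<delta> (n t) t) (\<rho> t))"
        unfolding gauge_on_def
      proof
        fix t assume "t \<in> U"
        then have "t \<in> B (n t)" using n int by blast
        then show "0 < min (\<delta> (n t) t) (\<rho> t)" using \<delta>(1) \<rho>(1) by (simp add: gauge_on_def)
      qed
      fix \<pi> assume "M_partition_in \<pi> U \<and> fine_partition (\<lambda>t. min (\<delta> (n t) t) (\<rho> t)) \<pi>"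
      then have \<pi>: "M_partition_in \<pi> U" "fine_partition (\<lambda>t. \<delta> (n t) t) \<pi>" "fine_partition \<rho> \<pi>"
        by (auto simp: fine_partition_min)
      note \<pi>D = M_partition_inD[OF \<pi>(1)]
      define S where "S k = {p \<in> \<pi>. n (fst p) = k}" for k
      define \<Phi> where "\<Phi> p = measure lebesgue (snd p) *\<^sub>R f (fst p) - F (snd p)" for p
      have S: "norm (sum \<Phi> (S k)) \<le> \<epsilon> / 2 ^ (k + 2)" for k
      proof -
        have "M_partition_in (S k) (B k)"
          unfolding M_partition_in_def
        proof (intro conjI ballI impI)
          show "finite (S k)" using \<pi>D(1) by (simp add: S_def)
          fix p assume p: "p \<in> S k"
          then have p': "p \<in> \<pi>" "n (fst p) = k" by (auto simp: S_def)
          have "snd p \<subseteq> max_ball (fst p) (\<rho> (fst p))"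
            by (rule fine_partitionD[OF \<pi>(3) p'(1)])
          then have "snd p \<subseteq> B k" using \<rho>(2)[OF \<pi>D(4)[OF p'(1)]] p'(2) int by blast
          moreover have "fst p \<in> B k" using n[OF \<pi>D(4)[OF p'(1)]] p'(2) int by blast
          ultimately show "case p of (t, I) \<Rightarrow> t \<in> B k \<and> I \<in> intervals_in (B k)"
            using \<pi>D(5)[OF p'(1)] by (auto simp: intervals_in_def case_prod_beta)
          fix q assume "q \<in> S k" "p \<noteq> q"
          then show "nonoverlapping (snd p) (snd q)" using \<pi>D(6)[OF p'(1)] by (simp add: S_def)
        qed
        moreover have "fine_partition (\<delta> k) (S k)"
          using \<pi>(2) by (auto simp: fine_partition_def S_def)
        ultimately have "norm (\<Sum>(t, I)\<in>S k. measure lebesgue I *\<^sub>R f t - F I) < \<epsilon> / 2 ^ (k + 2)"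
          using \<delta>(2) by blast
        then show ?thesis by (simp add: \<Phi>_def case_prod_beta)
      qed
      have "(\<Sum>(t, I)\<in>\<pi>. measure lebesgue I *\<^sub>R f t - F I) = sum \<Phi> \<pi>"
        by (simp add: \<Phi>_def case_prod_beta)
      also have "\<dots> = (\<Sum>k\<in>(\<lambda>p. n (fst p)) ` \<pi>. sum \<Phi> (S k))"
        unfolding S_def by (rule sum.image_gen[OF \<pi>D(1)])
      also have "norm \<dots> \<le> (\<Sum>k\<in>(\<lambda>p. n (fst p)) ` \<pi>. \<epsilon> / 2 ^ (k + 2))"
        by (intro order_trans[OF norm_sum] sum_mono S)
      also have "\<dots> < \<epsilon>" using \<pi>D(1) \<epsilon> by (intro sum_half_powers_less) auto
      finally show "norm (\<Sum>(t, I)\<in>\<pi>. measure lebesgue I *\<^sub>R f t - F I) < \<epsilon>" .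
    qed
  qed
qed

lemma additive_interval_fun_subset:
  "additive_interval_fun F E \<Longrightarrow> E' \<subseteq> E \<Longrightarrow> additive_interval_fun F E'"
  unfolding additive_interval_fun_def intervals_in_def by blast

lemma additive_nondeg_ext:
  fixes I J :: "(real^'m) set"
  assumes F: "additive_interval_fun F W" and IJ: "is_box I" "is_box J" "is_box (I \<union> J)" "I \<union> J \<subseteq> W"
    and no: "nonoverlapping I J"
  shows "nondeg_ext F (I \<union> J) = nondeg_ext F I + nondeg_ext F J"
proof (cases "I \<union> J \<in> nondeg_intervals")
  case True
  \<comment> \<open>The two boxes become a family indexed by \<open>bool\<close>, so that
    \<open>additive_family\<close> covers the case of one flat box as well.\<close>
  define K where "K b = (if b then I else J)" for b
  have "(\<Sum>b\<in>UNIV. nondeg_ext F (K b)) = F (I \<union> J)"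
  proof (rule additive_family[OF F IJ(4) True])
    show "nonoverlapping (K a) (K b)" if "a \<noteq> b" for a b
      using that no nonoverlapping_sym[OF no] by (cases a; cases b) (auto simp: K_def)
  qed (auto simp: K_def IJ split: if_splits)
  moreover have "K True = I" "K False = J" by (simp_all add: K_def)
  ultimately have "nondeg_ext F I + nondeg_ext F J = F (I \<union> J)" by (simp add: UNIV_bool add.commute)
  moreover have "nondeg_ext F (I \<union> J) = F (I \<union> J)" using True by (simp add: nondeg_ext_def)
  ultimately show ?thesis by simp
next
  case False
  then have "interior (I \<union> J) = {}" using IJ(3) by (simp add: nondeg_intervals_iff)
  then have "interior I = {}" "interior J = {}"
    using interior_mono[of I "I \<union> J"] interior_mono[of J "I \<union> J"] by auto
  then have "I \<notin> nondeg_intervals" "J \<notin> nondeg_intervals" by (simp_all add: nondeg_intervals_iff)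
  then show ?thesis using False by (simp add: nondeg_ext_def)
qed

lemma meeting_sum_nondeg_ext:
  fixes F :: "(real^'m) set \<Rightarrow> 'x::real_normed_vector"
  assumes I: "is_box I" and D: "D \<in> divisions_in E"
  shows "(\<lambda>k. F (I \<inter> D k)) summable_on meeting_indices I D \<longleftrightarrow>
      (\<lambda>k. nondeg_ext F (I \<inter> D k)) summable_on UNIV"
    and "(\<Sum>\<^sub>\<infinity>k\<in>meeting_indices I D. F (I \<inter> D k)) = (\<Sum>\<^sub>\<infinity>k. nondeg_ext F (I \<inter> D k))"
proof -
  have m: "meeting_indices I D = {k. I \<inter> D k \<in> nondeg_intervals}"
    by (rule meeting_indices_eq[OF I divisions_inD(1)[OF D]])
  show "(\<lambda>k. F (I \<inter> D k)) summable_on meeting_indices I D \<longleftrightarrow>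
      (\<lambda>k. nondeg_ext F (I \<inter> D k)) summable_on UNIV"
    unfolding m by (rule summable_on_cong_neutral) (auto simp: nondeg_ext_def)
  show "(\<Sum>\<^sub>\<infinity>k\<in>meeting_indices I D. F (I \<inter> D k)) = (\<Sum>\<^sub>\<infinity>k. nondeg_ext F (I \<inter> D k))"
    unfolding m by (rule infsum_cong_neutral) (auto simp: nondeg_ext_def)
qed

subsection \<open>The three characterizations\<close>

text \<open>The two functions differ on \<open>W\<close> only within the null set
  \<open>G - interior G\<close>. This replaces \<open>f0\<close> by a function vanishing off an open
  set, as both directions between the first two conditions of the theorem require.\<close>

lemma henstock_primitive_zero_extension:
  fixes f f0 :: "real^'m \<Rightarrow> 'x::real_normed_vector"
  assumes "G - interior G \<in> null_sets lebesgue" "G \<subseteq> W"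
    and "\<And>t. t \<in> G \<Longrightarrow> f0 t = f t" "\<And>t. t \<in> W - G \<Longrightarrow> f0 t = 0"
  shows "henstock_primitive f0 F W \<longleftrightarrow>
    henstock_primitive (\<lambda>t. if t \<in> interior G then f t else 0) F W"
proof -
  define f1 where "f1 t = (if t \<in> interior G then f t else 0)" for t
  have neg: "negligible (G - interior G)" using assms(1) by (simp add: negligible_iff_null_sets)
  have "f0 t = f1 t" if "t \<in> W" "t \<notin> G - interior G" for t
    using assms(3,4) interior_subset[of G] that by (cases "t \<in> G") (auto simp: f1_def)
  then have "{t \<in> W. f0 t \<noteq> f1 t} \<subseteq> G - interior G" by blast
  then have "{t \<in> W. f0 t \<noteq> f1 t} \<in> null_sets lebesgue"
    using neg negligible_subset unfolding negligible_iff_null_sets[symmetric] by blast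
  moreover have "{t \<in> W. f1 t \<noteq> f0 t} = {t \<in> W. f0 t \<noteq> f1 t}" by auto
  ultimately have "{t \<in> W. f0 t \<noteq> f1 t} \<in> null_sets lebesgue" "{t \<in> W. f1 t \<noteq> f0 t} \<in> null_sets lebesgue"
    by simp_all
  then have "henstock_primitive f0 F W \<longleftrightarrow> henstock_primitive f1 F W"
    using henstock_primitive_null_change by blast
  then show ?thesis unfolding f1_def .
qed

lemma dunford_mcshane_imp_mcshane:
  fixes G W :: "(real^'m) set" and f f0 :: "real^'m \<Rightarrow> 'x::banach"
  assumes G: "bounded G" "interior G \<noteq> {}" "G - interior G \<in> null_sets lebesgue"
    and W: "W \<in> nondeg_intervals" "G \<subseteq> W"
    and f0: "\<And>t. t \<in> G \<Longrightarrow> f0 t = f t" "\<And>t. t \<in> W - G \<Longrightarrow> f0 t = 0"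
    and f: "dunford_mcshane_integrable_with_primitive f G F"
  shows "\<exists>F0. mcshane_integrable_with_primitive f0 W F0 \<and> (\<forall>I \<in> intervals_in G. F0 I = F I)"
proof -
  define U where "U = interior G"
  have U: "open U" "U \<subseteq> G" "U \<noteq> {}" "bounded U"
    using G interior_subset[of G] by (auto simp: U_def bounded_interior)
  have henstock: "henstock_primitive f F U" and dunford: "dunford_function F G"
    and negl: "M_negligible_variation_over F G (- U)"
    using f unfolding dunford_mcshane_integrable_with_primitive_def henstock_primitive_def
      M_negligible_variation_outside_interior_def U_def by auto
  have add: "additive_interval_fun F G" using dunford by (simp add: dunford_function_def)
  obtain B where "B \<in> intervals_in U" using open_interval_around[OF U(1)] U(3) by blast
  then obtain D where D: "D \<in> divisions_of U"
    using division_containing_interval[OF U(1,4)] by blast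
  then have DU: "D \<in> divisions_in U" by (simp add: divisions_of_def)
  have DG: "D \<in> divisions_in G" by (rule divisions_in_mono[OF DU U(2)])
  \<comment> \<open>One division is fixed, yet on intervals in \<open>G\<close> the value is
    \<open>F I\<close> by the second clause of \<open>dunford_function\<close>; additivity is
    inherited term by term from \<open>F\<close>.\<close>
  define F0 where "F0 I = (\<Sum>\<^sub>\<infinity>k. nondeg_ext F (I \<inter> D k))" for I
  have meet: "(\<Sum>\<^sub>\<infinity>k\<in>meeting_indices I D. F (I \<inter> D k)) = F0 I" if "I \<in> nondeg_intervals" for I
    unfolding F0_def by (rule meeting_sum_nondeg_ext(2)[OF nondeg_is_box[OF that] DG])
  have summable: "(\<lambda>k. nondeg_ext F (I \<inter> D k)) summable_on UNIV" if "I \<in> nondeg_intervals" for I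
    using dunford DG that meeting_sum_nondeg_ext(1)[OF nondeg_is_box[OF that] DG]
    unfolding dunford_function_def by blast
  have eq: "F0 I = F I" if "I \<in> intervals_in G" for I
    using dunford D DG that meet[of I] unfolding dunford_function_def U_def intervals_in_def by simp
  have add0: "additive_interval_fun F0 W"
    unfolding additive_interval_fun_def
  proof (intro ballI impI)
    fix I J assume IJ: "I \<in> intervals_in W" "J \<in> intervals_in W"
      and un: "nonoverlapping I J \<and> I \<union> J \<in> intervals_in W"
    have n: "I \<in> nondeg_intervals" "J \<in> nondeg_intervals" "I \<union> J \<in> nondeg_intervals"
      using IJ un by (auto simp: intervals_in_def)
    have "nondeg_ext F ((I \<union> J) \<inter> D k) = nondeg_ext F (I \<inter> D k) + nondeg_ext F (J \<inter> D k)" for k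
      unfolding Int_Un_distrib2
    proof (rule additive_nondeg_ext[OF add])
      have box: "is_box (K \<inter> D k)" if "K \<in> nondeg_intervals" for K
        by (rule is_box_Int[OF nondeg_is_box[OF that] divisions_inD(1)[OF DG]])
      show "is_box (I \<inter> D k)" "is_box (J \<inter> D k)" using n(1,2) by (auto intro: box)
      show "is_box (I \<inter> D k \<union> J \<inter> D k)"
        unfolding Int_Un_distrib2[symmetric] by (rule box[OF n(3)])
      show "I \<inter> D k \<union> J \<inter> D k \<subseteq> G" using divisions_inD(2)[OF DG] by blast
      show "nonoverlapping (I \<inter> D k) (J \<inter> D k)"
        using un by (auto intro: nonoverlapping_subset)
    qed
    then show "F0 (I \<union> J) = F0 I + F0 J"
      unfolding F0_def using infsum_add[OF summable[OF n(1)] summable[OF n(2)]] by simp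
  qed
  define f1 where "f1 t = (if t \<in> U then f t else 0)" for t
  have "henstock_primitive f1 F0 W"
    unfolding henstock_primitive_def
  proof (intro allI impI)
    fix \<epsilon> :: real assume \<epsilon>: "\<epsilon> > 0"
    obtain \<delta>1 where \<delta>1: "gauge_on U \<delta>1" "\<forall>\<pi>. M_partition_in \<pi> U \<and> fine_partition \<delta>1 \<pi> \<longrightarrow>
        norm (\<Sum>(t, I)\<in>\<pi>. measure lebesgue I *\<^sub>R f t - F I) < \<epsilon> / 2"
      using henstock \<epsilon> unfolding henstock_primitive_def by (meson half_gt_zero)
    obtain \<delta>2 where \<delta>2: "gauge_on (- U) \<delta>2" 
      "\<forall>\<pi>. M_partition_in \<pi> UNIV \<and> tagged_in (- U) \<pi> \<and> fine_partition \<delta>2 \<pi> \<longrightarrow>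
           (\<forall>D \<in> divisions_of (interior G).
              (\<forall>(t, I) \<in> \<pi>. (\<lambda>k. F (I \<inter> D k)) summable_on meeting_indices I D) \<and>
              norm (\<Sum>(t, I) \<in> \<pi>. \<Sum>\<^sub>\<infinity>k \<in> meeting_indices I D. F (I \<inter> D k)) < \<epsilon> / 2)"
      using negl \<epsilon> unfolding M_negligible_variation_over_def by (meson half_gt_zero)
    have "\<exists>r>0. t \<in> U \<longrightarrow> max_ball t r \<subseteq> U" for t
      using max_ball_in_open[OF U(1), of t] zero_less_one by blast
    then obtain \<rho> where \<rho>: "\<And>t. \<rho> t > 0" "\<And>t. t \<in> U \<Longrightarrow> max_ball t (\<rho> t) \<subseteq> U" by metis
    \<comment> \<open>For tags in \<open>U\<close> the interval is kept inside \<open>U\<close>,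
      where \<open>F0\<close> and \<open>F\<close> agree; the other tags follow the gauge of the
      negligible variation.\<close>
    define \<delta> where "\<delta> t = (if t \<in> U then min (\<delta>1 t) (\<rho> t) else \<delta>2 t)" for t
    show "\<exists>\<delta>. gauge_on W \<delta> \<and> (\<forall>\<pi>. M_partition_in \<pi> W \<and> fine_partition \<delta> \<pi> \<longrightarrow>
        norm (\<Sum>(t, I)\<in>\<pi>. measure lebesgue I *\<^sub>R f1 t - F0 I) < \<epsilon>)"
    proof (intro exI[of _ \<delta>] conjI allI impI)
      show "gauge_on W \<delta>" using \<delta>1(1) \<delta>2(1) \<rho>(1) by (auto simp: gauge_on_def \<delta>_def)
      fix \<pi> assume "M_partition_in \<pi> W \<and> fine_partition \<delta> \<pi>"
      then have \<pi>: "M_partition_in \<pi> W" and fine: "fine_partition \<delta> \<pi>" by auto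
      note \<pi>D = M_partition_inD[OF \<pi>]
      have fineD: "snd p \<subseteq> max_ball (fst p) (\<delta> (fst p))" if "p \<in> \<pi>" for p
        by (rule fine_partitionD[OF fine that])
      define \<Phi> where "\<Phi> p = measure lebesgue (snd p) *\<^sub>R f1 (fst p) - F0 (snd p)" for p
      define \<pi>1 where "\<pi>1 = {p \<in> \<pi>. fst p \<in> U}"
      define \<pi>2 where "\<pi>2 = {p \<in> \<pi>. fst p \<notin> U}"
      have sub1: "snd p \<subseteq> U \<and> snd p \<subseteq> max_ball (fst p) (\<delta>1 (fst p))" if "p \<in> \<pi>1" for p
      proof -
        have p: "p \<in> \<pi>" "fst p \<in> U" using that by (auto simp: \<pi>1_def)
        have "snd p \<subseteq> max_ball (fst p) (min (\<delta>1 (fst p)) (\<rho> (fst p)))"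
          using fineD[OF p(1)] p(2) by (simp add: \<delta>_def)
        then have "snd p \<subseteq> max_ball (fst p) (\<delta>1 (fst p))" "snd p \<subseteq> max_ball (fst p) (\<rho> (fst p))"
          by (auto simp: max_ball_def)
        then show ?thesis using \<rho>(2)[OF p(2)] by blast
      qed
      have in1: "p \<in> \<pi>" "fst p \<in> U" "snd p \<in> intervals_in U" if "p \<in> \<pi>1" for p
        using that \<pi>D(5)[of p] sub1[OF that] by (auto simp: intervals_in_def \<pi>1_def)
      have part1: "M_partition_in \<pi>1 U"
        unfolding M_partition_in_def
      proof (intro conjI ballI impI)
        show "finite \<pi>1" using \<pi>D(1) by (simp add: \<pi>1_def)
        fix p assume p: "p \<in> \<pi>1"
        show "case p of (t, I) \<Rightarrow> t \<in> U \<and> I \<in> intervals_in U"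
          using in1(2,3)[OF p] by (simp add: case_prod_beta)
        fix q assume q: "q \<in> \<pi>1" and "p \<noteq> q"
        then show "nonoverlapping (snd p) (snd q)" by (intro \<pi>D(6) in1(1) p q)
      qed
      have fine1: "fine_partition \<delta>1 \<pi>1"
        unfolding fine_partition_def using sub1 by (simp add: case_prod_beta)
      have sum1: "norm (sum \<Phi> \<pi>1) < \<epsilon> / 2"
      proof -
        have "sum \<Phi> \<pi>1 = (\<Sum>(t, I)\<in>\<pi>1. measure lebesgue I *\<^sub>R f t - F I)"
        proof (rule sum.cong[OF refl])
          fix p assume p: "p \<in> \<pi>1"
          have "snd p \<in> intervals_in G" using in1(3)[OF p] U(2) by (auto simp: intervals_in_def)
          then show "\<Phi> p = (case p of (t, I) \<Rightarrow> measure lebesgue I *\<^sub>R f t - F I)"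
            using in1(2)[OF p] eq by (simp add: \<Phi>_def f1_def case_prod_beta)
        qed
        then show ?thesis using \<delta>1(2) part1 fine1 by simp
      qed
      have sub2: "\<pi>2 \<subseteq> \<pi>" by (auto simp: \<pi>2_def)
      have part2: "M_partition_in \<pi>2 UNIV"
        using M_partition_in_subset[OF \<pi> sub2] by (rule M_partition_in_mono) simp
      have tag2: "tagged_in (- U) \<pi>2" by (auto simp: tagged_in_def \<pi>2_def)
      have fine2: "fine_partition \<delta>2 \<pi>2"
        unfolding fine_partition_def
      proof
        fix p assume p: "p \<in> \<pi>2"
        then show "case p of (t, I) \<Rightarrow> I \<subseteq> max_ball t (\<delta>2 t)"
          using fineD[of p] by (simp add: \<pi>2_def \<delta>_def case_prod_beta)
      qed
      have sum2: "norm (sum \<Phi> \<pi>2) < \<epsilon> / 2"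
      proof -
        \<comment> \<open>The function \<open>f1\<close> vanishes at these tags, so only the series
          survive, and their sum is what the negligible variation bounds.\<close>
        have "sum \<Phi> \<pi>2 = - (\<Sum>(t, I) \<in> \<pi>2. \<Sum>\<^sub>\<infinity>k \<in> meeting_indices I D. F (I \<inter> D k))"
          unfolding sum_negf[symmetric]
        proof (rule sum.cong[OF refl])
          fix p assume p: "p \<in> \<pi>2"
          then have "snd p \<in> nondeg_intervals" using \<pi>D(5) sub2 by blast
          then show "\<Phi> p = - (case p of (t, I) \<Rightarrow> \<Sum>\<^sub>\<infinity>k \<in> meeting_indices I D. F (I \<inter> D k))"
            using p meet by (simp add: \<Phi>_def f1_def \<pi>2_def case_prod_beta)
        qed
        then show ?thesis using \<delta>2(2) part2 tag2 fine2 D unfolding U_def by simp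
      qed
      have "sum \<Phi> \<pi> = sum \<Phi> \<pi>1 + sum \<Phi> \<pi>2"
        using \<pi>D(1) by (subst sum.union_disjoint[symmetric]) (auto simp: \<pi>1_def \<pi>2_def intro!: sum.cong)
      then have "norm (sum \<Phi> \<pi>) < \<epsilon>" using norm_add_less_halves[OF sum1 sum2] by simp
      then show "norm (\<Sum>(t, I)\<in>\<pi>. measure lebesgue I *\<^sub>R f1 t - F0 I) < \<epsilon>"
        by (simp add: \<Phi>_def case_prod_beta)
    qed
  qed
  then have "henstock_primitive f0 F0 W"
    using henstock_primitive_zero_extension[OF G(3) W(2), of f0 f F0] f0 unfolding f1_def U_def by blast
  then have "mcshane_integrable_with_primitive f0 W F0"
    by (rule henstock_imp_mcshane_primitive[OF W(1) add0])
  then show ?thesis using eq by blast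
qed

text \<open>The negligible variation concerns partitions in the whole space, whereas
  \<open>F0\<close> is controlled only in \<open>W\<close>. Each interval is therefore replaced by
  its intersection with \<open>W\<close>, and \<open>f1\<close> being 0 at tags outside
  \<open>U\<close> turns the Saks-Henstock estimate into a bound on \<open>F0\<close> alone.\<close>

lemma mcshane_imp_dunford_negligible:
  fixes G W :: "(real^'m) set" and f f0 :: "real^'m \<Rightarrow> 'x::banach"
  assumes G: "bounded G" "G - interior G \<in> null_sets lebesgue"
    and W: "W \<in> nondeg_intervals" "G \<subseteq> W"
    and F: "additive_interval_fun F G"
    and f0: "\<And>t. t \<in> G \<Longrightarrow> f0 t = f t" "\<And>t. t \<in> W - G \<Longrightarrow> f0 t = 0"
    and prim: "mcshane_integrable_with_primitive f0 W F0"
    and eq: "\<And>I. I \<in> intervals_in G \<Longrightarrow> F0 I = F I"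
  shows "dunford_function F G" "M_negligible_variation_outside_interior F G"
proof -
  define U where "U = interior G"
  have U: "open U" "U \<subseteq> G" "U \<subseteq> W" using W(2) interior_subset[of G] by (auto simp: U_def)
  define f1 where "f1 t = (if t \<in> U then f t else 0)" for t
  have add0: "additive_interval_fun F0 W" by (rule mcshane_primitive_additive[OF W(1) prim])
  have f1: "henstock_primitive f1 F0 W"
    using mcshane_primitive_henstock[OF W(1) prim]
      henstock_primitive_zero_extension[OF G(2) W(2), of f0 f F0] f0 unfolding f1_def U_def by blast
  have f1_0: "f1 t = 0" if "t \<in> W - U" for t using that by (simp add: f1_def)
  have ext: "nondeg_ext F I = nondeg_ext F0 I" if "I \<subseteq> G" for I
    using eq that by (simp add: nondeg_ext_def intervals_in_def)
  have extD: "nondeg_ext F (I \<inter> D k) = nondeg_ext F0 (I \<inter> D k)" if "D \<in> divisions_in G" for I D k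
    by (rule ext) (use divisions_inD(2)[OF that] in blast)
  have summable: "(\<lambda>k. F (I \<inter> D k)) summable_on meeting_indices I D"
    if D: "D \<in> divisions_in G" and I: "I \<in> nondeg_intervals" for D I
    unfolding meeting_sum_nondeg_ext(1)[OF nondeg_is_box[OF I] D] extD[OF D]
    by (rule henstock_primitive_summable[OF W(1) add0 f1 divisions_in_mono[OF D W(2)] nondeg_is_box[OF I]])
  have UG: "D \<in> divisions_in G" if "D \<in> divisions_of U" for D
    using that U(2) divisions_in_mono by (auto simp: divisions_of_def)
  have has_sum: "((\<lambda>k. nondeg_ext F (I \<inter> D k)) has_sum F0 I) UNIV"
    if D: "D \<in> divisions_of U" and I: "I \<in> intervals_in W" for D I
    unfolding extD[OF UG[OF D]]
    by (rule henstock_primitive_has_sum[OF W(1) add0 f1 U(1,3) f1_0 D I])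
  show "dunford_function F G"
    unfolding dunford_function_def
  proof (intro conjI ballI impI)
    show "additive_interval_fun F G" by (rule F)
    fix D assume D: "D \<in> divisions_in G"
    show "(\<lambda>k. F (I \<inter> D k)) summable_on meeting_indices I D" if "I \<in> nondeg_intervals" for I
      by (rule summable[OF D that])
    fix I assume DU: "D \<in> divisions_of (interior G)" and I: "I \<in> intervals_in G"
    have I': "I \<in> intervals_in W" "is_box I" 
      using I W(2) by (auto simp: intervals_in_def nondeg_is_box)
    show "F I = (\<Sum>\<^sub>\<infinity>k\<in>meeting_indices I D. F (I \<inter> D k))"
      unfolding meeting_sum_nondeg_ext(2)[OF I'(2) D]
      using infsumI[OF has_sum[OF DU[folded U_def] I'(1)]] eq[OF I] by simp
  qed
  show "M_negligible_variation_outside_interior F G"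
    unfolding M_negligible_variation_outside_interior_def M_negligible_variation_over_def U_def[symmetric]
  proof (intro conjI allI impI)
    show "additive_interval_fun F G" by (rule F)
    fix \<epsilon> :: real assume \<epsilon>: "\<epsilon> > 0"
    obtain \<delta>1 where \<delta>1: "gauge_on W \<delta>1" "\<forall>\<pi>. M_partition_in \<pi> W \<and> fine_partition \<delta>1 \<pi> \<longrightarrow>
        norm (\<Sum>(t, I)\<in>\<pi>. measure lebesgue I *\<^sub>R f1 t - F0 I) < \<epsilon>"
      using f1 \<epsilon> unfolding henstock_primitive_def by meson
    have "closed W" using nondeg_is_box[OF W(1)] by (auto elim: is_boxE)
    then have "open (- W)" by (rule open_Compl)
    \<comment> \<open>Intervals tagged outside \<open>W\<close> then miss \<open>W\<close> entirely
      and contribute nothing.\<close>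
    then have "\<exists>r>0. t \<notin> W \<longrightarrow> max_ball t r \<subseteq> - W" for t
      using max_ball_in_open[of "- W" t] zero_less_one by blast
    then obtain \<rho> where \<rho>: "\<And>t. \<rho> t > 0" "\<And>t. t \<notin> W \<Longrightarrow> max_ball t (\<rho> t) \<subseteq> - W" by metis
    define \<delta> where "\<delta> t = (if t \<in> W then \<delta>1 t else \<rho> t)" for t
    show "\<exists>\<delta>. gauge_on (- U) \<delta> \<and> (\<forall>\<pi>. M_partition_in \<pi> UNIV \<and> tagged_in (- U) \<pi> \<and> fine_partition \<delta> \<pi> \<longrightarrow>
       (\<forall>D\<in>divisions_of U. (\<forall>(t, I)\<in>\<pi>. (\<lambda>k. F (I \<inter> D k)) summable_on meeting_indices I D) \<and>
          norm (\<Sum>(t, I)\<in>\<pi>. \<Sum>\<^sub>\<infinity>k\<in>meeting_indices I D. F (I \<inter> D k)) < \<epsilon>))"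
    proof (intro exI[of _ \<delta>] conjI allI impI ballI)
      show "gauge_on (- U) \<delta>" using \<delta>1(1) \<rho>(1) by (auto simp: gauge_on_def \<delta>_def)
      fix \<pi> D assume "M_partition_in \<pi> UNIV \<and> tagged_in (- U) \<pi> \<and> fine_partition \<delta> \<pi>"
        and D: "D \<in> divisions_of U"
      then have \<pi>: "M_partition_in \<pi> UNIV" and tag: "\<And>p. p \<in> \<pi> \<Longrightarrow> fst p \<notin> U" 
        and fine: "\<And>p. p \<in> \<pi> \<Longrightarrow> snd p \<subseteq> max_ball (fst p) (\<delta> (fst p))"
        by (auto simp: tagged_in_def dest: fine_partitionD)
      note \<pi>D = M_partition_inD[OF \<pi>]
      note DG = UG[OF D]
      show "case p of (t, I) \<Rightarrow> (\<lambda>k. F (I \<inter> D k)) summable_on meeting_indices I D" if "p \<in> \<pi>" for p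
        using summable[OF DG \<pi>D(5)[OF that]] by (simp add: case_prod_beta)
      have Wb: "is_box W" using W(1) by (rule nondeg_is_box)
      \<comment> \<open>The members of \<open>D\<close> lie in \<open>W\<close>, so the series sees
        only \<open>snd p \<inter> W\<close>. The resulting value does not depend on
        \<open>D\<close>, hence one gauge serves all divisions.\<close>
      have pair_sum: "(\<Sum>\<^sub>\<infinity>k\<in>meeting_indices (snd p) D. F (snd p \<inter> D k)) = nondeg_ext F0 (snd p \<inter> W)"
        if p: "p \<in> \<pi>" for p
      proof -
        have Int: "snd p \<inter> D k = snd p \<inter> W \<inter> D k" for k
          using divisions_inD(2)[OF DG, of k] W(2) by blast
        show ?thesis
        proof (cases "snd p \<inter> W \<in> nondeg_intervals")
          case True
          then have "snd p \<inter> W \<in> intervals_in W" by (simp add: intervals_in_def)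
          from infsumI[OF has_sum[OF D this]] show ?thesis
            using True unfolding meeting_sum_nondeg_ext(2)[OF \<pi>D(2)[OF p] DG] Int[symmetric]
            by (simp add: nondeg_ext_def)
        next
          case False
          have "is_box (snd p \<inter> W)" using \<pi>D(2)[OF p] Wb by (rule is_box_Int)
          then have "interior (snd p \<inter> W) = {}" using False by (simp add: nondeg_intervals_iff)
          then have "interior (snd p \<inter> D k) = {}" for k
            using interior_mono[of "snd p \<inter> D k" "snd p \<inter> W"] Int[of k] by blast
          then have "nondeg_ext F (snd p \<inter> D k) = 0" for k
            by (simp add: nondeg_ext_def nondeg_intervals_iff del: interior_Int)
          then show ?thesis
            using False unfolding meeting_sum_nondeg_ext(2)[OF \<pi>D(2)[OF p] DG]
            by (simp add: nondeg_ext_def)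
        qed
      qed
      define A where "A = {p \<in> \<pi>. fst p \<in> W}"
      have A: "p \<in> \<pi>" "fst p \<in> W" if "p \<in> A" for p using that by (auto simp: A_def)
      have "norm (\<Sum>p\<in>A. measure lebesgue (snd p \<inter> W) *\<^sub>R f1 (fst p) - nondeg_ext F0 (snd p \<inter> W)) < \<epsilon>"
      proof (rule henstock_primitive_family[OF \<delta>1(2)])
        show "finite A" using \<pi>D(1) by (simp add: A_def)
        show "nonoverlapping (snd p \<inter> W) (snd q \<inter> W)" if "p \<in> A" "q \<in> A" "p \<noteq> q" for p q
          by (rule nonoverlapping_subset[OF \<pi>D(6)[OF A(1)[OF that(1)] A(1)[OF that(2)] that(3)]]) auto
        fix p assume p: "p \<in> A"
        show "is_box (snd p \<inter> W)" using \<pi>D(2)[OF A(1)[OF p]] Wb by (rule is_box_Int)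
        show "fst p \<in> W" by (rule A(2)[OF p])
        show "snd p \<inter> W \<subseteq> W" by blast
        show "snd p \<inter> W \<subseteq> max_ball (fst p) (\<delta>1 (fst p))"
          using fine[OF A(1)[OF p]] A(2)[OF p] by (auto simp: \<delta>_def)
      qed
      moreover have "f1 (fst p) = 0" if "p \<in> A" for p
        using tag[OF A(1)[OF that]] by (simp add: f1_def)
      ultimately have less: "norm (\<Sum>p\<in>A. nondeg_ext F0 (snd p \<inter> W)) < \<epsilon>"
        by (simp add: sum_negf)
      have "(\<Sum>p\<in>A. nondeg_ext F0 (snd p \<inter> W)) = (\<Sum>p\<in>\<pi>. nondeg_ext F0 (snd p \<inter> W))"
      proof (rule sum.mono_neutral_left[OF \<pi>D(1)])
        show "A \<subseteq> \<pi>" by (auto simp: A_def)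
        show "\<forall>p\<in>\<pi> - A. nondeg_ext F0 (snd p \<inter> W) = 0"
        proof
          fix p assume "p \<in> \<pi> - A"
          then have "p \<in> \<pi>" "fst p \<notin> W" by (auto simp: A_def)
          then have "snd p \<inter> W = {}" using fine[of p] \<rho>(2)[of "fst p"] by (auto simp: \<delta>_def)
          then show "nondeg_ext F0 (snd p \<inter> W) = 0" by (simp add: nondeg_ext_def nondeg_intervals_iff)
        qed
      qed
      also have "\<dots> = (\<Sum>(t, I)\<in>\<pi>. \<Sum>\<^sub>\<infinity>k\<in>meeting_indices I D. F (I \<inter> D k))"
        using pair_sum by (intro sum.cong) (auto simp: case_prod_beta)
      finally show "norm (\<Sum>(t, I)\<in>\<pi>. \<Sum>\<^sub>\<infinity>k\<in>meeting_indices I D. F (I \<inter> D k)) < \<epsilon>"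
        using less by simp
    qed
  qed
qed

text \<open>The primitive on \<open>W\<close> and the one on \<open>B\<close> are defined by
  integrals over different intervals; the Saks-Henstock property compares them, as it restricts to
  \<open>B\<close> directly.\<close>

lemma mcshane_restrict_subinterval:
  fixes f f0 :: "real^'m \<Rightarrow> 'x::real_normed_vector"
  assumes W: "W \<in> nondeg_intervals" "G \<subseteq> W" and F: "additive_interval_fun F G"
    and f0: "\<And>t. t \<in> G \<Longrightarrow> f0 t = f t"
    and prim: "mcshane_integrable_with_primitive f0 W F0"
    and eq: "\<And>I. I \<in> intervals_in G \<Longrightarrow> F0 I = F I"
    and B: "B \<in> intervals_in G"
  shows "mcshane_integrable_with_primitive f B F"
proof -
  have B': "B \<in> nondeg_intervals" "B \<subseteq> G" "B \<subseteq> W" using B W(2) by (auto simp: intervals_in_def)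
  have "henstock_primitive f0 F0 B"
    by (rule henstock_primitive_subset[OF mcshane_primitive_henstock[OF W(1) prim] B'(3)])
  then have "henstock_primitive f F B"
    by (rule henstock_primitive_cong) (use B'(2) f0 eq in \<open>auto simp: intervals_in_def\<close>)
  then show ?thesis
    by (rule henstock_imp_mcshane_primitive[OF B'(1) additive_interval_fun_subset[OF F B'(2)]])
qed

theorem theorem3p3:
  fixes G I0 :: "(real^'m) set"
    and f f0 :: "real^'m \<Rightarrow> 'x::banach"
    and F :: "(real^'m) set \<Rightarrow> 'x"
  assumes "bounded G"
    and "interior G \<noteq> {}"
    and "G - interior G \<in> null_sets lebesgue"
    and "I0 \<in> nondeg_intervals"
    and "G \<subseteq> I0"
    and "additive_interval_fun F G"
    and "\<And>t. t \<in> G \<Longrightarrow> f0 t = f t"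
    and "\<And>t. t \<in> I0 - G \<Longrightarrow> f0 t = 0"
  defines "i \<equiv> dunford_mcshane_integrable_with_primitive f G F"
    and "ii \<equiv> \<exists>F0. mcshane_integrable_with_primitive f0 I0 F0 \<and>
                   (\<forall>I \<in> intervals_in G. F0 I = F I)"
    and "iii \<equiv> dunford_function F G \<and> M_negligible_variation_outside_interior F G \<and>
               (\<forall>C \<in> divisions_of (interior G). \<forall>k.
                  mcshane_integrable_with_primitive f (C k) F)"
  shows "(i \<longleftrightarrow> ii) \<and> (ii \<longleftrightarrow> iii)"
proof -
  have "i \<Longrightarrow> ii"
    unfolding i_def ii_def by (rule dunford_mcshane_imp_mcshane[OF assms(1-5,7,8)])
  moreover have "ii \<Longrightarrow> iii"
  proof -
    assume ii
    then obtain F0 where F0: "mcshane_integrable_with_primitive f0 I0 F0"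
      "\<And>I. I \<in> intervals_in G \<Longrightarrow> F0 I = F I" unfolding ii_def by blast
    have "C k \<in> intervals_in G" if "C \<in> divisions_of (interior G)" for C k
      using that interior_subset[of G] by (auto simp: divisions_of_def divisions_in_def intervals_in_def)
    then show iii
      unfolding iii_def
      using mcshane_imp_dunford_negligible[OF assms(1,3-8) F0]
        mcshane_restrict_subinterval[OF assms(4-7) F0] by blast
  qed
  moreover have "iii \<Longrightarrow> i"
  proof -
    assume iii: iii
    have "henstock_primitive f F (interior G)"
    proof (rule henstock_primitive_open[OF open_interior])
      fix B assume B: "B \<in> intervals_in (interior G)"
      \<comment> \<open>The third condition speaks only of members of divisions; here an arbitrary
        interval in \<open>interior G\<close> is recognised as such a member.\<close>
      obtain C k where "C \<in> divisions_of (interior G)" "B = C k"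
        using division_containing_interval[OF open_interior bounded_interior[OF assms(1)] B] by blast
      then have "mcshane_integrable_with_primitive f B F" using iii unfolding iii_def by blast
      then show "henstock_primitive f F B"
        using B by (intro mcshane_primitive_henstock) (auto simp: intervals_in_def)
    qed
    then show i
      using iii unfolding i_def iii_def dunford_mcshane_integrable_with_primitive_def henstock_primitive_def
      by blast
  qed
  ultimately show ?thesis by blast
qed

end
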